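(* Let $f(x)\in\mathbb{F}_{q^n}[x]$ be a scattered polynomial, with $q>3$ and $n>2$. (i) If $|G_f|=q-1$ (i.e. $f\notin\mathcal{S}_{n,q}$), then the plane $\mathcal{A}_f$ admits no nontrivial group of affine central collineations, and the group of all collineations of $\mathcal{A}_f$ lying in $\mathrm{GL}(2,q^n)$ has order $q^n-1$ and equals the kernel homology group $\{(x,y)\mapsto(ax,ay)\colon a\in\mathbb{F}_{q^n}^*\}$ of the associated Desarguesian plane. (ii) If $f\in\mathcal{S}_{n,q}$ and $G_f$ is isomorphic to $\mathbb{F}_{q^t}^*$, then $\mathcal{A}_f$ admits cyclic symmetric affine homology groups of order $(q^t-1)/(q-1)$ but admits no nontrivial affine elation; there exist two distinct components $X$ and $Y$ of $\mathcal{A}_f$ such that every affine homology of $\mathcal{A}_f$ has center $X$ or $Y$, and $X,Y$ are elements of the Desarguesian spread $\mathcal{D}$ of $\mathbb{F}_{q^n}^2$; moreover the group of all collineations of $\mathcal{A}_f$ lying in $\mathrm{GL}(2,q^n)$ is the direct product of the kernel homology group of the associated Desarguesian plane (of order $q^n-1$) by a cyclic homology group of order $(q^t-1)/(q-1)$.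
   Context: $q$ is a prime power. A $q$-polynomial $f(x)=\sum_{i=0}^{n-1}a_ix^{q^i}\in\mathbb{F}_{q^n}[x]$ is scattered if for all $y,z\in\mathbb{F}_{q^n}$, $zf(y)-yf(z)=0$ implies $y,z$ are $\mathbb{F}_q$-linearly dependent. $U_f=\{(x,f(x))\colon x\in\mathbb{F}_{q^n}\}$; matrices act by $(x,y)\mapsto(x,y)A$; $G_f=\{A\in\mathrm{GL}(2,q^n)\colon U_fA=U_f\}$ (it always contains the scalar matrices $aI$, $a\in\mathbb{F}_q^*$); $\mathcal{S}_{n,q}$ is the set of scattered $f$ with $|G_f|>q-1$. $L_f=\{\langle(x,f(x))\rangle_{\mathbb{F}_{q^n}}\colon x\ne0\}$, $\mathcal{D}=\{\langle v\rangle_{\mathbb{F}_{q^n}}\colon v\ne0\}$; $\mathcal{B}_f=(\mathcal{D}\setminus L_f)\cup\{hU_f\colon h\in\mathbb{F}_{q^n}^*\}$ is a spread of $\mathbb{F}_{q^n}^2$ (as $2n$-dim $\mathbb{F}_q$-space), and $\mathcal{A}_f$ is the translation plane with points the vectors of $\mathbb{F}_{q^n}^2$ and lines the cosets $v+W$, $W\in\mathcal{B}_f$; the elements of $\mathcal{B}_f$ (components) are also the points at infinity. A central collineation of a projective plane is a nonidentity collineation fixing a line (axis) pointwise; it then fixes all lines through a unique point (center); it is an elation if the center lies on the axis and a homology otherwise. An affine central collineation (affine homology, affine elation) of $\mathcal{A}_f$ is a collineation whose extension to the projective closure is a central collineation (homology, elation) whose axis is an affine line; its center is then a component; an affine line through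 the center is a coaxis. Two groups $G,H$ of affine homologies are symmetric affine homology groups if there are lines $\ell,m$ such that $\ell$ is the axis of every element of $G$ and a coaxis of every element of $H$, and $m$ is the axis of every element of $H$ and a coaxis of every element of $G$. *)

theory Defs
  imports "HOL-Library.Cardinality" "HOL-Algebra.Group" "HOL-Computational_Algebra.Primes"
begin

definition prime_power :: "nat \<Rightarrow> bool" where
  "prime_power q \<longleftrightarrow> (\<exists>p k. prime p \<and> 0 < k \<and> q = p ^ k)"

definition Fq :: "nat \<Rightarrow> 'a::field set" where
  "Fq q = {x. x ^ q = x}"

definition qpoly :: "nat \<Rightarrow> nat \<Rightarrow> (nat \<Rightarrow> 'a::field) \<Rightarrow> 'a \<Rightarrow> 'a" where
  "qpoly q n a x = (\<Sum>i<n. a i * x ^ (q ^ i))"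

definition Fq_dependent :: "nat \<Rightarrow> 'a::field \<Rightarrow> 'a \<Rightarrow> bool" where
  "Fq_dependent q y z \<longleftrightarrow>
     (\<exists>l m. l \<in> Fq q \<and> m \<in> Fq q \<and> (l \<noteq> 0 \<or> m \<noteq> 0) \<and> l * y + m * z = 0)"

definition scattered :: "nat \<Rightarrow> ('a::field \<Rightarrow> 'a) \<Rightarrow> bool" where
  "scattered q f \<longleftrightarrow> (\<forall>y z. z * f y - y * f z = 0 \<longrightarrow> Fq_dependent q y z)"

text \<open>(a11, a12, a21, a22)\<close>
type_synonym 'a mat2 = "'a \<times> 'a \<times> 'a \<times> 'a"

definition act :: "'a::field mat2 \<Rightarrow> 'a \<times> 'a \<Rightarrow> 'a \<times> 'a" where
  "act A v = (case A of (a, b, c, d) \<Rightarrow> (fst v * a + snd v * c, fst v * b + snd v * d))"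

definition GL2 :: "'a::field mat2 set" where
  "GL2 = {(a, b, c, d). a * d - b * c \<noteq> 0}"

definition mat2_mult :: "'a::field mat2 \<Rightarrow> 'a mat2 \<Rightarrow> 'a mat2" where
  "mat2_mult A B = (case A of (a, b, c, d) \<Rightarrow> case B of (e, f, g, h) \<Rightarrow>
      (a * e + b * g, a * f + b * h, c * e + d * g, c * f + d * h))"

definition mat2_one :: "'a::field mat2" where
  "mat2_one = (1, 0, 0, 1)"

definition Uf :: "('a::field \<Rightarrow> 'a) \<Rightarrow> ('a \<times> 'a) set" where
  "Uf f = {(x, f x) | x. True}"

definition Gf :: "('a::field \<Rightarrow> 'a) \<Rightarrow> 'a mat2 set" where
  "Gf f = {A \<in> GL2. act A ` Uf f = Uf f}"

definition Gf_group :: "('a::field \<Rightarrow> 'a) \<Rightarrow> 'a mat2 monoid" where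
  "Gf_group f = \<lparr>carrier = Gf f, monoid.mult = mat2_mult, one = mat2_one\<rparr>"

definition mult_group_field :: "'b::field monoid" where
  "mult_group_field = \<lparr>carrier = UNIV - {0}, monoid.mult = (*), one = 1\<rparr>"

definition S_nq :: "nat \<Rightarrow> nat \<Rightarrow> ('a::field \<Rightarrow> 'a) set" where
  "S_nq n q = {f. (\<exists>a. f = qpoly q n a) \<and> scattered q f \<and> q - 1 < card (Gf f)}"

definition span1 :: "'a::field \<times> 'a \<Rightarrow> ('a \<times> 'a) set" where
  "span1 v = {(c * fst v, c * snd v) | c. True}"

definition Dspread :: "('a::field \<times> 'a) set set" where
  "Dspread = {span1 v | v. v \<noteq> (0, 0)}"

definition Lf :: "('a::field \<Rightarrow> 'a) \<Rightarrow> ('a \<times> 'a) set set" where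
  "Lf f = {span1 (x, f x) | x. x \<noteq> 0}"

definition Bf :: "('a::field \<Rightarrow> 'a) \<Rightarrow> ('a \<times> 'a) set set" where
  "Bf f = (Dspread - Lf f) \<union> {{(h * x, h * f x) | x. True} | h. h \<noteq> 0}"

definition translate :: "'a::field \<times> 'a \<Rightarrow> ('a \<times> 'a) set \<Rightarrow> ('a \<times> 'a) set" where
  "translate v W = (\<lambda>w. (fst v + fst w, snd v + snd w)) ` W"

definition lines :: "('a::field \<Rightarrow> 'a) \<Rightarrow> ('a \<times> 'a) set set" where
  "lines f = {translate v W | v W. W \<in> Bf f}"

definition collineation :: "('a::field \<Rightarrow> 'a) \<Rightarrow> ('a \<times> 'a \<Rightarrow> 'a \<times> 'a) \<Rightarrow> bool" where
  "collineation f g \<longleftrightarrow> bij g \<and> (\<forall>L. L \<in> lines f \<longleftrightarrow> g ` L \<in> lines f)"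

definition dir :: "('a::field \<Rightarrow> 'a) \<Rightarrow> ('a \<times> 'a) set \<Rightarrow> ('a \<times> 'a) set" where
  "dir f L = (THE W. W \<in> Bf f \<and> (\<exists>v. L = translate v W))"

text \<open>Points: affine points (Inl) and components (Inr); lines: affine lines (Some) and
  the line at infinity (None).\<close>
definition proj_points :: "('a::field \<Rightarrow> 'a) \<Rightarrow> (('a \<times> 'a) + ('a \<times> 'a) set) set" where
  "proj_points f = Inl ` UNIV \<union> Inr ` Bf f"

definition proj_lines :: "('a::field \<Rightarrow> 'a) \<Rightarrow> ('a \<times> 'a) set option set" where
  "proj_lines f = Some ` lines f \<union> {None}"

definition proj_inc :: "(('a::field \<times> 'a) + ('a \<times> 'a) set) \<Rightarrow> ('a \<times> 'a) set option \<Rightarrow> bool" where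
  "proj_inc P l = (case l of
       None \<Rightarrow> (case P of Inl _ \<Rightarrow> False | Inr _ \<Rightarrow> True)
     | Some L \<Rightarrow> (case P of Inl p \<Rightarrow> p \<in> L | Inr W \<Rightarrow> (\<exists>v. L = translate v W)))"

definition ext :: "('a::field \<Rightarrow> 'a) \<Rightarrow> ('a \<times> 'a \<Rightarrow> 'a \<times> 'a)
    \<Rightarrow> ('a \<times> 'a) + ('a \<times> 'a) set \<Rightarrow> ('a \<times> 'a) + ('a \<times> 'a) set" where
  "ext f g P = (case P of Inl p \<Rightarrow> Inl (g p) | Inr W \<Rightarrow> Inr (dir f (g ` W)))"

definition central_collineation ::
  "'p set \<Rightarrow> 'l set \<Rightarrow> ('p \<Rightarrow> 'l \<Rightarrow> bool) \<Rightarrow> ('p \<Rightarrow> 'p) \<Rightarrow> 'l \<Rightarrow> 'p \<Rightarrow> bool" where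
  "central_collineation P Ls inc s ax c \<longleftrightarrow>
     ax \<in> Ls \<and> c \<in> P \<and> (\<exists>p\<in>P. s p \<noteq> p) \<and>
     (\<forall>p\<in>P. inc p ax \<longrightarrow> s p = p) \<and>
     (\<forall>l\<in>Ls. inc c l \<longrightarrow> s ` {p\<in>P. inc p l} = {p\<in>P. inc p l})"

definition affine_central ::
  "('a::field \<Rightarrow> 'a) \<Rightarrow> ('a \<times> 'a \<Rightarrow> 'a \<times> 'a) \<Rightarrow> ('a \<times> 'a) set \<Rightarrow> ('a \<times> 'a) + ('a \<times> 'a) set \<Rightarrow> bool" where
  "affine_central f g ax c \<longleftrightarrow> collineation f g \<and> ax \<in> lines f \<and>
     central_collineation (proj_points f) (proj_lines f) proj_inc (ext f g) (Some ax) c"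

definition affine_homology ::
  "('a::field \<Rightarrow> 'a) \<Rightarrow> ('a \<times> 'a \<Rightarrow> 'a \<times> 'a) \<Rightarrow> ('a \<times> 'a) set \<Rightarrow> ('a \<times> 'a) + ('a \<times> 'a) set \<Rightarrow> bool" where
  "affine_homology f g ax c \<longleftrightarrow> affine_central f g ax c \<and> \<not> proj_inc c (Some ax)"

definition affine_elation ::
  "('a::field \<Rightarrow> 'a) \<Rightarrow> ('a \<times> 'a \<Rightarrow> 'a \<times> 'a) \<Rightarrow> ('a \<times> 'a) set \<Rightarrow> ('a \<times> 'a) + ('a \<times> 'a) set \<Rightarrow> bool" where
  "affine_elation f g ax c \<longleftrightarrow> affine_central f g ax c \<and> proj_inc c (Some ax)"

definition cyclic_map_group :: "('p \<Rightarrow> 'p) set \<Rightarrow> nat \<Rightarrow> bool" where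
  "cyclic_map_group G N \<longleftrightarrow> (\<exists>g. bij g \<and> G = range (\<lambda>k. g ^^ k)) \<and> card G = N"

definition symmetric_affine_homology_groups ::
  "('a::field \<Rightarrow> 'a) \<Rightarrow> ('a \<times> 'a \<Rightarrow> 'a \<times> 'a) set \<Rightarrow> ('a \<times> 'a \<Rightarrow> 'a \<times> 'a) set \<Rightarrow> bool" where
  "symmetric_affine_homology_groups f G H \<longleftrightarrow>
     (\<exists>ax bx. ax \<in> lines f \<and> bx \<in> lines f \<and>
        (\<forall>g\<in>G. g \<noteq> id \<longrightarrow> (\<exists>c. affine_homology f g ax c \<and> proj_inc c (Some bx))) \<and>
        (\<forall>h\<in>H. h \<noteq> id \<longrightarrow> (\<exists>c. affine_homology f h bx c \<and> proj_inc c (Some ax))))"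

definition CollGL :: "('a::field \<Rightarrow> 'a) \<Rightarrow> 'a mat2 set" where
  "CollGL f = {A \<in> GL2. collineation f (act A)}"

definition kernel_homologies :: "'a::field mat2 set" where
  "kernel_homologies = {(a, 0, 0, a) | a. a \<noteq> 0}"

definition mat2_cyclic :: "'a::field mat2 set \<Rightarrow> bool" where
  "mat2_cyclic C \<longleftrightarrow> (\<exists>g\<in>GL2. C = range (\<lambda>k. (mat2_mult g ^^ k) mat2_one))"

end

(*
  An affine central collineation of A_f fixes, after a translation, a component W pointwise and
  has a component X as centre; comparing images of components shows that it is additive.  An
  additive collineation maps more than a third of the Desarguesian components to Desarguesian
  components, and since a proper subfield of F_{q^n} has at most q^(n/2) elements, this forces it
  to be semilinear over F_{q^n}.  The axis cannot be one of the subspaces h U_f (the fixed field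
  of the companion automorphism would be too small), so it is an F_{q^n}-line and the collineation
  is linear.  Everything is thereby reduced to the linear collineations, which are the products
  of scalars with elements of G_f.

  If G_f is cyclic of order q^t - 1 > q - 1, a generator A is not scalar.  It has an eigenvector,
  since otherwise it would act semiregularly on U_f - {0} and satisfy A^(q^n - 1) = 1, a polynomial
  that splits over F_{q^n}; it is then diagonalizable because its order is prime to q.  An
  eigenline meeting U_f would make q^(n-1) elements of F_{q^n} invariant under the other eigenvalue
  and put both eigenvalues into F_q, contradicting scatteredness.  So both eigenlines are components,
  and they serve as axes and centres of all affine homologies.
*)
theory Submission
  imports Defs "HOL-Library.Product_Plus" "HOL-Number_Theory.Residues"
    "HOL-Computational_Algebra.Polynomial"
begin

section \<open>Finite fields and counting\<close>

text \<open>The obstacle is that a collineation is at first only a permutation of points, and that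
  the components are of two kinds: the subspaces h U_f admit scalars from F_q only, so nothing
  forces a collineation to respect multiplication by F_{q^n}. Additivity is therefore obtained
  synthetically, with components that are mere subgroups, and scalars enter by counting. Both
  \<open>Lf f\<close> and the family of all h U_f have at most (q^n - 1)/(q - 1) members, which is
  less than q^n/3 because q > 3; this is where the third of the overview comes from. The hypothesis
  n > 2 acts through q^2 < q^n, which rules out an axis h U_f, and through q < q^(n-1), which rules
  out an eigenline meeting U_f. The order (q^t - 1)/(q - 1) is that of G_f divided by the number of
  its scalars: normalising every element by its eigenvalue on a fixed eigenvector maps G_f onto a
  homology group with fibres of q - 1 elements.\<close>

lemma power_card_UNIV_eq_same:
  fixes x :: "'a::{field,finite}"
  shows "x ^ CARD('a) = x"
proof (cases "x = 0")
  case False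
  have "x * (\<Prod>y\<in>UNIV-{0}. x * y) = x * x ^ (CARD('a) - 1) * \<Prod>(UNIV-{0})"
    by (simp add: prod.distrib mult_ac card_Diff_singleton)
  also have "x * x ^ (CARD('a) - 1) = x ^ CARD('a)"
    by (metis Suc_pred' power_Suc zero_less_card_finite)
  also have "(\<Prod>y\<in>UNIV-{0}. x * y) = (\<Prod>y\<in>UNIV-{0}. y)"
    by (rule prod.reindex_bij_witness[of _ "\<lambda>y. y / x" "\<lambda>y. x * y"]) (use False in auto)
  finally show ?thesis
    by simp
qed simp

lemma card_le_card_image_mult:
  assumes "finite A" and "\<And>x. x \<in> A \<Longrightarrow> k \<le> card {y\<in>A. F y = F x}"
  shows "k * card (F ` A) \<le> card A"
proof -
  have "k * card (F ` A) = (\<Sum>b\<in>F ` A. k)" by simp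
  also have "\<dots> \<le> (\<Sum>b\<in>F ` A. card {y\<in>A. F y = b})"
    by (intro sum_mono) (use assms(2) in auto)
  also have "\<dots> = card (\<Union>b\<in>F ` A. {y\<in>A. F y = b})"
    by (rule card_UN_disjoint[symmetric]) (use assms(1) in auto)
  also have "(\<Union>b\<in>F ` A. {y\<in>A. F y = b}) = A" by auto
  finally show ?thesis .
qed

lemma card_eq_card_image_mult:
  assumes "finite A" and "\<And>x. x \<in> A \<Longrightarrow> card {y\<in>A. F y = F x} = k"
  shows "card A = k * card (F ` A)"
proof -
  have "k * card (F ` A) = (\<Sum>b\<in>F ` A. k)" by simp
  also have "\<dots> = (\<Sum>b\<in>F ` A. card {y\<in>A. F y = b})"
    by (intro sum.cong) (use assms(2) in auto)
  also have "\<dots> = card (\<Union>b\<in>F ` A. {y\<in>A. F y = b})"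
    by (rule card_UN_disjoint[symmetric]) (use assms(1) in auto)
  also have "(\<Union>b\<in>F ` A. {y\<in>A. F y = b}) = A" by auto
  finally show ?thesis by simp
qed

text \<open>For nonzero \<open>b\<close>, multiplication by \<open>b\<close> permutes
  \<open>S - {0}\<close>, so the product of its elements absorbs the factor
  \<open>b ^ (card S - 1)\<close>. \<open>S\<close> may be a mere set of coordinates.\<close>

lemma power_card_eq_if_mult_image_eq:
  fixes S :: "'a::field set"
  assumes "finite S" "0 \<in> S" "(*) b ` S = S"
  shows "b ^ card S = b"
proof (cases "b = 0")
  case True
  then show ?thesis using assms by (auto simp: card_gt_0_iff power_0_left)
next
  case False
  have bij: "bij_betw ((*) b) (S - {0}) (S - {0})"
  proof -
    have "(*) b ` (S - {0}) = S - {0}"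
      using assms False by (subst image_set_diff) (auto simp: inj_on_def)
    then show ?thesis using False by (auto simp: bij_betw_def inj_on_def)
  qed
  have "b ^ card (S - {0}) * (\<Prod>y\<in>S-{0}. y) = (\<Prod>y\<in>S-{0}. b * y)"
    by (simp add: prod.distrib)
  also have "\<dots> = (\<Prod>y\<in>S-{0}. y)"
    by (rule prod.reindex_bij_betw[OF bij])
  finally have "b ^ card (S - {0}) = 1"
    using assms(1) by simp
  moreover have "card S = Suc (card (S - {0}))"
    using assms by (intro card.remove) auto
  ultimately show ?thesis by (simp only: power_Suc mult_1_right)
qed

lemma card_roots_of_unity_le:
  assumes "0 < d"
  shows "card {x::'a::{field,finite}. x ^ d = c} \<le> d"
proof -
  let ?p = "monom (1::'a) d + [:- c:]"
  have deg: "degree ?p = d"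
    using assms by (subst degree_add_eq_left) (auto simp: degree_monom_eq)
  then have "?p \<noteq> 0" using assms by auto
  then have "card {x. poly ?p x = 0} \<le> d"
    using card_poly_roots_bound[of ?p] deg by simp
  then show ?thesis by (simp add: poly_monom)
qed

text \<open>The exponent \<open>th\<close> = (q^n - 1)/(q - 1) is that of the norm: the power map
  sends nonzero elements to (q - 1)-th roots of unity with fibres of at most \<open>th\<close>
  elements, so there are at least q - 1 such roots.\<close>

lemma card_Fq:
  assumes card: "CARD('a::{field,finite}) = q ^ n" and q: "q > 1" and n: "n > 0"
  shows "card (Fq q :: 'a set) = q"
proof -
  define th where "th = (\<Sum>i<n. q ^ i)"
  have "int ((q - 1) * th) = int (q ^ n - 1)"
    using q power_diff_1_eq[of "int q" n]
    by (simp add: th_def of_nat_diff sum_distrib_left one_le_power)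
  then have th: "(q - 1) * th = q ^ n - 1" by linarith
  have th0: "th > 0"
    using q n by (auto simp: th_def intro!: sum_pos)
  let ?S = "{x::'a. x ^ (q - 1) = 1}"
  have Fq_eq: "(Fq q :: 'a set) = insert 0 ?S"
  proof (rule Set.set_eqI)
    fix x :: 'a
    have "x ^ q = x * x ^ (q - 1)"
      using q by (metis Suc_diff_1 less_trans power_Suc zero_less_one)
    then show "x \<in> Fq q \<longleftrightarrow> x \<in> insert 0 ?S"
      by (auto simp: Fq_def)
  qed
  have "card ((\<lambda>x::'a. x ^ th) ` (UNIV - {0})) \<le> card ?S"
  proof (intro card_mono)
    show "(\<lambda>x::'a. x ^ th) ` (UNIV - {0}) \<subseteq> ?S"
    proof clarify
      fix x :: 'a assume "x \<noteq> 0"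
      moreover have "x * x ^ (q ^ n - 1) = x"
        using power_card_UNIV_eq_same[of x] q card
        by (metis One_nat_def Suc_pred power_Suc zero_less_card_finite)
      ultimately show "(x ^ th) ^ (q - 1) = 1"
        using th by (simp add: mult.commute[of th] flip: power_mult)
    qed
  qed simp
  moreover have "card (UNIV - {0::'a}) \<le> th * card ((\<lambda>x::'a. x ^ th) ` (UNIV - {0}))"
  proof -
    have "card (UNIV - {0::'a}) =
        card (\<Union>b\<in>(\<lambda>x::'a. x ^ th) ` (UNIV - {0}). {y\<in>UNIV - {0}. y ^ th = b})"
      by (intro arg_cong[where f=card]) auto
    also have "\<dots> = (\<Sum>b\<in>(\<lambda>x::'a. x ^ th) ` (UNIV - {0}). card {y\<in>UNIV - {0}. y ^ th = b})"
      by (rule card_UN_disjoint) auto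
    also have "\<dots> \<le> (\<Sum>b\<in>(\<lambda>x::'a. x ^ th) ` (UNIV - {0}). th)"
    proof (intro sum_mono)
      fix b :: 'a
      have "card {y\<in>UNIV - {0}. y ^ th = b} \<le> card {y. y ^ th = b}"
        by (intro card_mono) auto
      also have "\<dots> \<le> th" by (rule card_roots_of_unity_le[OF th0])
      finally show "card {y\<in>UNIV - {0}. y ^ th = b} \<le> th" .
    qed
    finally show ?thesis by (simp add: mult.commute)
  qed
  ultimately have "th * (q - 1) \<le> th * card ?S"
    using th card by (simp add: card_Diff_singleton mult.commute)
      (meson le_trans mult_le_mono2)
  then have "q - 1 \<le> card ?S" using th0 by simp
  moreover have "card ?S \<le> q - 1"
    using q by (intro card_roots_of_unity_le) simp
  moreover have "card (Fq q :: 'a set) = Suc (card ?S)"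
    unfolding Fq_eq using q by (subst card_insert_disjoint) (auto simp: power_0_left)
  ultimately show ?thesis using q by simp
qed

lemma CHAR_eq_prime:
  assumes "CARD('a::{field,finite}) = p ^ m" and p: "prime p"
  shows "CHAR('a) = p"
proof -
  have "prime CHAR('a)"
    using finite_imp_CHAR_pos[where 'a='a] by (intro prime_CHAR_semidom) simp
  moreover have "CHAR('a) dvd p ^ m"
    using CHAR_dvd_CARD[where 'a='a] assms(1) by simp
  ultimately show ?thesis
    using p by (metis prime_dvd_power primes_dvd_imp_eq)
qed

lemma add_power_prime_power:
  fixes x y :: "'a::{field,finite}"
  assumes "CARD('a) = q ^ n" and "prime_power q"
  shows "(x + y) ^ q = x ^ q + y ^ q"
proof -
  obtain p k where p: "prime p" "q = p ^ k" using assms by (auto simp: prime_power_def)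
  then have "CHAR('a) = p"
    using assms(1) by (intro CHAR_eq_prime[of p "k * n"]) (simp_all add: power_mult)
  then show ?thesis
    using p by (intro freshmans_dream') auto
qed

text \<open>Some \<open>g\<close> has \<open>g ^ j\<close> different from 1, because that equation
  has at most \<open>j\<close> roots. Replacing \<open>k\<close> by \<open>g * k\<close> multiplies
  the sum by \<open>g ^ j\<close> yet only permutes its terms. In
  \<open>eigenvector_if_power_fixes\<close> this leaves the exponent 0 alone.\<close>

lemma sum_power_nonzero_eq_0:
  assumes "0 < j" "j < CARD('a) - 1"
  shows "(\<Sum>k\<in>UNIV - {0::'a::{field,finite}}. k ^ j) = 0"
proof -
  have "card (UNIV - {0::'a}) = CARD('a) - 1" by (simp add: card_Diff_singleton)
  then have "\<not> UNIV - {0::'a} \<subseteq> {x. x ^ j = 1}"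
    using card_roots_of_unity_le[OF assms(1), of "1::'a"] assms(2)
      card_mono[of "{x::'a. x ^ j = 1}" "UNIV - {0::'a}"] by auto
  then obtain g :: 'a where g: "g \<noteq> 0" "g ^ j \<noteq> 1" by auto
  have "g ^ j * (\<Sum>k\<in>UNIV - {0::'a}. k ^ j) = (\<Sum>k\<in>UNIV - {0::'a}. (g * k) ^ j)"
    by (simp add: sum_distrib_left power_mult_distrib)
  also have "\<dots> = (\<Sum>k\<in>UNIV - {0::'a}. k ^ j)"
    by (rule sum.reindex_bij_witness[of _ "\<lambda>k. k / g" "\<lambda>k. g * k"]) (use g in auto)
  finally show ?thesis using g by (simp add: mult_cancel_right1)
qed

text \<open>
  Under the hypothesis, all orbits of \<open>f\<close> have the same length.
\<close>
lemma funpow_card_eq_id: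
  assumes fin: "finite S" and ne: "S \<noteq> {}" and bij: "bij_betw f S S"
    and semireg: "\<And>i s. s \<in> S \<Longrightarrow> (f ^^ i) s = s \<Longrightarrow> \<forall>x\<in>S. (f ^^ i) x = x"
  shows "\<forall>x\<in>S. (f ^^ card S) x = x"
proof -
  have inS: "(f ^^ i) s \<in> S" if "s \<in> S" for i s
    using that bij by (induction i) (auto simp: bij_betw_def)
  have injS: "s = s'" if "s \<in> S" "s' \<in> S" "(f ^^ i) s = (f ^^ i) s'" for i s s'
    using that
  proof (induction i)
    case (Suc i)
    then have "(f ^^ i) s = (f ^^ i) s'"
      using bij inS[OF Suc.prems(1), of i] inS[OF Suc.prems(2), of i]
      by (auto simp: bij_betw_def inj_on_def)
    then show ?case using Suc by blast
  qed simp
  obtain s0 where s0: "s0 \<in> S" using ne by blast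
  have "\<not> inj_on (\<lambda>i. (f ^^ i) s0) UNIV"
  proof
    assume "inj_on (\<lambda>i. (f ^^ i) s0) UNIV"
    then have "infinite (range (\<lambda>i. (f ^^ i) s0))" by (rule range_inj_infinite)
    moreover have "range (\<lambda>i. (f ^^ i) s0) \<subseteq> S" using inS s0 by auto
    ultimately show False using fin finite_subset by blast
  qed
  then obtain i j where "i < j" "(f ^^ i) s0 = (f ^^ j) s0"
    unfolding inj_on_def by (metis linorder_neqE_nat)
  then have "(f ^^ i) s0 = (f ^^ i) ((f ^^ (j - i)) s0)"
    by (metis add_diff_inverse_nat comp_apply funpow_add less_imp_le not_less)
  then have ex: "\<exists>m>0. (f ^^ m) s0 = s0"
    using injS[of s0 "(f ^^ (j - i)) s0" i] s0 inS \<open>i < j\<close> by (metis zero_less_diff)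
  \<comment> \<open>The least period of the single point \<open>s0\<close>: by
    \<open>semireg\<close> it is a period of every point of \<open>S\<close>, and no point has a
    smaller one.\<close>
  define m where "m = (LEAST m. m > 0 \<and> (f ^^ m) s0 = s0)"
  have m: "m > 0" "(f ^^ m) s0 = s0"
    using LeastI_ex[OF ex] unfolding m_def by auto
  have mS: "\<forall>x\<in>S. (f ^^ m) x = x" using semireg[OF s0 m(2)] .
  have min: "i = 0" if "i < m" "(f ^^ i) s = s" "s \<in> S" for i s
  proof (rule ccontr)
    assume "i \<noteq> 0"
    moreover have "(f ^^ i) s0 = s0" using semireg[OF that(3,2)] s0 by blast
    ultimately have "m \<le> i" unfolding m_def by (intro Least_le) auto
    then show False using that by simp
  qed
  define orb where "orb = (\<lambda>s. (\<lambda>i. (f ^^ i) s) ` {..<m})"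
  have card_orb: "card (orb s) = m" if "s \<in> S" for s
  proof -
    have "inj_on (\<lambda>i. (f ^^ i) s) {..<m}"
    proof (rule linorder_inj_onI')
      fix i j assume ij: "i \<in> {..<m}" "j \<in> {..<m}" "i < j"
      show "(f ^^ i) s \<noteq> (f ^^ j) s"
      proof
        assume "(f ^^ i) s = (f ^^ j) s"
        then have "(f ^^ i) s = (f ^^ i) ((f ^^ (j - i)) s)"
          by (metis add_diff_inverse_nat comp_apply funpow_add less_imp_le not_less ij(3))
        then have "(f ^^ (j - i)) s = s"
          using injS[of s "(f ^^ (j - i)) s" i] that inS by metis
        then have "j - i = 0" using min[of "j - i" s] ij that less_imp_diff_less[of j m] by simp
          then show False using ij by simp
      qed
    qed
    then show ?thesis by (simp add: orb_def card_image)
  qed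
  have mult: "(f ^^ (m * l)) s = s" if "s \<in> S" for l s
    using that mS by (induction l) (auto simp: funpow_add)
  have mod: "(f ^^ i) s = (f ^^ (i mod m)) s" if "s \<in> S" for i s
  proof -
    have "(f ^^ i) s = (f ^^ (i mod m + m * (i div m))) s" by simp
    also have "\<dots> = (f ^^ (i mod m)) ((f ^^ (m * (i div m))) s)"
      by (simp only: funpow_add comp_apply)
    finally show ?thesis by (simp add: mult that)
  qed
  have orb_iff: "orb s = range (\<lambda>i. (f ^^ i) s)" if "s \<in> S" for s
  proof
    show "range (\<lambda>i. (f ^^ i) s) \<subseteq> orb s"
      using mod[OF that] m(1) by (force simp: orb_def)
  qed (auto simp: orb_def)
  have orb_eq: "orb ((f ^^ i) s) = orb s" if s: "s \<in> S" for i s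
  proof -
    have sub: "orb ((f ^^ i) s) \<subseteq> orb s" if "s \<in> S" for i s
      unfolding orb_iff[OF that] orb_iff[OF inS[OF that]]
      by (auto simp: image_iff) (metis comp_apply funpow_add)
    have "(f ^^ (m * i - i)) ((f ^^ i) s) = (f ^^ (m * i - i + i)) s"
      by (simp only: funpow_add comp_apply)
    also have "m * i - i + i = m * i" using m(1) by simp
    finally have "(f ^^ (m * i - i)) ((f ^^ i) s) = s" using mult[OF s] by simp
    then have "orb s \<subseteq> orb ((f ^^ i) s)"
      using sub[OF inS[OF s, of i], of "m * i - i"] by simp
    then show ?thesis using sub[OF s] by blast
  qed
  have "m * card (orb ` S) = card (\<Union>(orb ` S))"
  proof (rule card_partition)
    show "finite (\<Union>(orb ` S))" using fin by (auto simp: orb_def)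
    show "card c = m" if "c \<in> orb ` S" for c using that card_orb by auto
    fix c1 c2 assume c: "c1 \<in> orb ` S" "c2 \<in> orb ` S" "c1 \<noteq> c2"
    then obtain s1 s2 where s: "c1 = orb s1" "c2 = orb s2" "s1 \<in> S" "s2 \<in> S" by blast
    show "c1 \<inter> c2 = {}"
    proof (rule ccontr)
      assume "c1 \<inter> c2 \<noteq> {}"
      then obtain i1 i2 where "(f ^^ i1) s1 = (f ^^ i2) s2"
        using s by (auto simp: orb_def)
      then have "orb s1 = orb s2" using orb_eq s(3,4) by metis
      then show False using c s by simp
    qed
  qed (use fin in simp)
  also have "\<Union>(orb ` S) = S"
  proof
    show "\<Union>(orb ` S) \<subseteq> S" using inS by (auto simp: orb_def)
    show "S \<subseteq> \<Union>(orb ` S)" using m(1) by (force simp: orb_def)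
  qed
  finally show ?thesis using mult by metis
qed

text \<open>The record \<open>R\<close> presents the type-class field as a HOL-Algebra field, for
  which a generator of the multiplicative group is available.\<close>

lemma finite_field_mult_cyclic:
  "\<exists>g::'b::{field,finite}. g \<noteq> 0 \<and> (\<forall>x. x \<noteq> 0 \<longrightarrow> (\<exists>i. x = g ^ i))"
proof -
  define R :: "'b ring" where "R = \<lparr>carrier = UNIV, monoid.mult = (*), one = 1,
    ring.zero = 0, add = (+)\<rparr>"
  have ex: "\<exists>y. x + y = 0" "x \<noteq> 0 \<Longrightarrow> \<exists>y. x * y = 1" for x :: 'b
    using add.right_inverse by (blast, intro exI[of _ "inverse x"] right_inverse)
  have "field R"
    unfolding R_def using ex by unfold_locales (auto simp: algebra_simps Units_def)
  then interpret R: field R .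
  have pow: "x [^]\<^bsub>R\<^esub> (i::nat) = x ^ i" for x i
    by (induction i) (auto simp: R_def mult.commute)
  have carr: "carrier (mult_of R) = UNIV - {0}"
    by (auto simp: R_def)
  have "\<exists>g\<in>carrier (mult_of R). carrier (mult_of R) = {g [^]\<^bsub>R\<^esub> i | i::nat. i \<in> UNIV}"
    by (rule R.finite_field_mult_group_has_gen) (simp add: R_def)
  then obtain g where g: "g \<in> carrier (mult_of R)"
      "carrier (mult_of R) = {g [^]\<^bsub>R\<^esub> i | i::nat. i \<in> UNIV}"
    by (elim bexE)
  have "x \<in> {g ^ i | i::nat. i \<in> UNIV}" if "x \<noteq> 0" for x
    using g(2) that unfolding carr pow by (metis DiffI UNIV_I singletonD)
  then show ?thesis using g(1) unfolding carr by blast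
qed

text \<open>A proper subring \<open>M\<close> closed under inverses and \<open>u \<notin> M\<close> give \<open>|M|\<^sup>2\<close> distinct elements \<open>x + u y\<close>.\<close>
lemma subfield_eq_UNIV:
  fixes M :: "'a::{field,finite} set"
  assumes diff: "\<And>x y. x \<in> M \<Longrightarrow> y \<in> M \<Longrightarrow> x - y \<in> M"
    and div: "\<And>x y. x \<in> M \<Longrightarrow> y \<in> M \<Longrightarrow> x / y \<in> M"
    and large: "CARD('a) < card M * card M"
  shows "M = UNIV"
proof (rule ccontr)
  assume "M \<noteq> UNIV"
  then obtain u where u: "u \<notin> M" by blast
  have "inj_on (\<lambda>(x, y). x + u * y) (M \<times> M)"
  proof (rule inj_onI, clarify)
    fix x y x' y' assume M: "x \<in> M" "y \<in> M" "x' \<in> M" "y' \<in> M"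
      and eq: "x + u * y = x' + u * y'"
    have "y = y'"
    proof (rule ccontr)
      assume "y \<noteq> y'"
      moreover have "u * (y - y') = x' - x" using eq by (simp add: algebra_simps)
      ultimately have "u = (x' - x) / (y - y')" by (simp add: field_simps)
      then show False using u M diff div by metis
    qed
    then show "x = x' \<and> y = y'" using eq by simp
  qed
  then have "card (M \<times> M) \<le> CARD('a)"
    by (rule card_inj_on_le) auto
  then show False using large by (simp add: card_cartesian_product)
qed

section \<open>Central collineations of a translation plane\<close>

text \<open>Components are only subgroups of an abelian group. This treats F_{q^n}-lines and the
  subspaces h U_f alike while nothing is known about scalars. \<open>third\<close> provides
  auxiliary components distinct from axis and centre.\<close>

locale spread =
  fixes B :: "'v::ab_group_add set set"
  assumes zero_mem: "W \<in> B \<Longrightarrow> 0 \<in> W"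
    and diff_mem: "W \<in> B \<Longrightarrow> x \<in> W \<Longrightarrow> y \<in> W \<Longrightarrow> x - y \<in> W"
    and nontrivial: "W \<in> B \<Longrightarrow> \<exists>w\<in>W. w \<noteq> 0"
    and cover: "\<exists>W\<in>B. v \<in> W"
    and unique: "W \<in> B \<Longrightarrow> Z \<in> B \<Longrightarrow> v \<in> W \<Longrightarrow> v \<in> Z \<Longrightarrow> v \<noteq> 0 \<Longrightarrow> W = Z"
    and sum: "W \<in> B \<Longrightarrow> Z \<in> B \<Longrightarrow> W \<noteq> Z \<Longrightarrow> \<exists>w\<in>W. \<exists>z\<in>Z. v = w + z"
    and third: "\<exists>Y\<in>B. Y \<noteq> W \<and> Y \<noteq> Z"
begin

definition line :: "'v \<Rightarrow> 'v set \<Rightarrow> 'v set" where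
  "line v W = (+) v ` W"

definition coll :: "('v \<Rightarrow> 'v) \<Rightarrow> bool" where
  "coll g \<longleftrightarrow> bij g \<and> (\<forall>L. (\<exists>v W. W \<in> B \<and> L = line v W) \<longleftrightarrow> (\<exists>v W. W \<in> B \<and> g ` L = line v W))"

lemma uminus_mem: "W \<in> B \<Longrightarrow> x \<in> W \<Longrightarrow> - x \<in> W"
  using diff_mem[of W 0 x] zero_mem by simp

lemma add_mem: "W \<in> B \<Longrightarrow> x \<in> W \<Longrightarrow> y \<in> W \<Longrightarrow> x + y \<in> W"
  using diff_mem[of W x "- y"] uminus_mem by simp

lemma mem_line_iff: "x \<in> line v W \<longleftrightarrow> x - v \<in> W"
  by (auto simp: line_def image_iff intro: bexI[of _ "x - v"])

lemma line_0 [simp]: "line 0 W = W"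
  by (simp add: line_def)

lemma self_mem_line: "W \<in> B \<Longrightarrow> v \<in> line v W"
  by (simp add: mem_line_iff zero_mem)

lemma line_eqI:
  assumes W: "W \<in> B" and x: "x \<in> line v W"
  shows "line v W = line x W"
proof -
  have "y - v \<in> W \<longleftrightarrow> y - x \<in> W" for y
    using diff_mem[OF W, of "y - v" "x - v"] add_mem[OF W, of "y - x" "x - v"] x
    by (auto simp: mem_line_iff)
  then show ?thesis by (auto simp: mem_line_iff)
qed

lemma line_subset_imp_eq:
  assumes "W \<in> B" "Z \<in> B" "line v W \<subseteq> line u Z"
  shows "W = Z"
proof -
  have "line u Z = line v Z"
    using assms self_mem_line line_eqI by blast
  then have "W \<subseteq> Z"
    using assms(3) by (force simp: line_def)
  then show ?thesis
    using nontrivial[OF assms(1)] unique assms(1,2) by blast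
qed

lemma line_inj: "W \<in> B \<Longrightarrow> Z \<in> B \<Longrightarrow> line v W = line u Z \<Longrightarrow> W = Z"
  using line_subset_imp_eq by blast

lemma lines_meet:
  assumes "W \<in> B" "Z \<in> B" "W \<noteq> Z"
  obtains x where "x \<in> line v W" "x \<in> line u Z"
proof -
  obtain w z where wz: "w \<in> W" "z \<in> Z" "u - v = w + z"
    using sum[OF assms] by metis
  have "v + w \<in> line v W" using wz by (simp add: mem_line_iff)
  moreover have "v + w - u = - z" using wz by (simp add: algebra_simps)
  then have "v + w \<in> line u Z" using uminus_mem[OF assms(2)] wz by (simp add: mem_line_iff)
  ultimately show ?thesis using that by blast
qed

lemma lines_meet_unique:
  assumes "W \<in> B" "Z \<in> B" "W \<noteq> Z" "x \<in> line v W" "x \<in> line u Z" "y \<in> line v W" "y \<in> line u Z"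
  shows "x = y"
proof -
  have "x - y \<in> W" "x - y \<in> Z"
    using diff_mem[of W "x - v" "y - v"] diff_mem[of Z "x - u" "y - u"] assms
    by (auto simp: mem_line_iff)
  then show ?thesis using unique[of W Z "x - y"] assms by auto
qed

lemma coll_imp_bij: "coll g \<Longrightarrow> bij g"
  by (simp add: coll_def)

lemma coll_line:
  assumes "coll g" "W \<in> B"
  obtains Z where "Z \<in> B" "g ` line v W = line (g v) Z"
proof -
  obtain u Z where Z: "Z \<in> B" "g ` line v W = line u Z"
    using assms unfolding coll_def by metis
  have "g v \<in> line u Z" using Z self_mem_line[OF assms(2)] by blast
  then show ?thesis using that Z line_eqI by metis
qed

text \<open>The action of \<open>g\<close> on the points at infinity. It is read off at the origin;
  by \<open>coll_image_line\<close> every other point gives the same component.\<close>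

definition gam :: "('v \<Rightarrow> 'v) \<Rightarrow> 'v set \<Rightarrow> 'v set" where
  "gam g W = (THE Z. Z \<in> B \<and> g ` W = line (g 0) Z)"

lemma gam_0:
  assumes "coll g" "W \<in> B"
  shows "gam g W \<in> B" "g ` W = line (g 0) (gam g W)"
proof -
  have "\<exists>!Z. Z \<in> B \<and> g ` W = line (g 0) Z"
    using coll_line[OF assms, of 0] line_inj by (metis line_0)
  from theI'[OF this] show "gam g W \<in> B" "g ` W = line (g 0) (gam g W)"
    unfolding gam_def by auto
qed

text \<open>Parallel lines are disjoint or equal, and this is preserved by a bijection on points.\<close>
lemma coll_image_line:
  assumes g: "coll g" and W: "W \<in> B"
  shows "g ` line v W = line (g v) (gam g W)"
proof -
  obtain Z where Z: "Z \<in> B" "g ` line v W = line (g v) Z"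
    using coll_line[OF g W] by metis
  have "Z = gam g W"
  proof (cases "v \<in> W")
    case True
    then have "line v W = W" using line_eqI[OF W, of v 0] by simp
    then show ?thesis
      using Z gam_0[OF g W] line_inj by metis
  next
    case False
    show ?thesis
    proof (rule ccontr)
      assume "Z \<noteq> gam g W"
      then obtain x where x: "x \<in> line (g v) Z" "x \<in> line (g 0) (gam g W)"
        using lines_meet Z gam_0[OF g W] by metis
      then obtain y y' where y: "y \<in> line v W" "y' \<in> W" "x = g y" "x = g y'"
        using Z gam_0[OF g W] by (metis imageE)
      then have "y = y'" using coll_imp_bij[OF g] by (auto simp: bij_def inj_def)
      then have "line v W = W" using y line_eqI[OF W, of y v] line_eqI[OF W, of y 0] by simp
      then show False using False self_mem_line[OF W, of v] by blast
    qed
  qed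
  then show ?thesis using Z by simp
qed

lemma gam_inj:
  assumes g: "coll g" and W: "W \<in> B" "Z \<in> B" and eq: "gam g W = gam g Z"
  shows "W = Z"
proof -
  have "g ` W = g ` Z" using gam_0[OF g] W eq by metis
  then have "W = Z" using coll_imp_bij[OF g] by (simp add: bij_def inj_image_eq_iff)
  then show ?thesis .
qed

text \<open>A line not parallel to the axis meets it in a fixed point and keeps its direction, so it
  is mapped to itself; two such lines through \<open>x\<close> fix \<open>x\<close>. This excludes
  an affine point as centre.\<close>

lemma id_if_all_directions_fixed:
  assumes g: "coll g" and W: "W \<in> B" and fix_axis: "\<And>w. w \<in> line v W \<Longrightarrow> g w = w"
    and dirs: "\<And>Z. Z \<in> B \<Longrightarrow> gam g Z = Z"
  shows "g x = x"
proof -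
  obtain Y where Y: "Y \<in> B" "Y \<noteq> W" using third by blast
  obtain Z where Z: "Z \<in> B" "Z \<noteq> W" "Z \<noteq> Y" using third by blast
  have on: "g x \<in> line x V" if V: "V \<in> B" "V \<noteq> W" for V
  proof -
    obtain p where p: "p \<in> line x V" "p \<in> line v W" using lines_meet V W by metis
    then have "g p = p" using fix_axis by simp
    then have "g ` line x V = line x V"
      using coll_image_line[OF g V(1), of p] line_eqI[OF V(1) p(1)] dirs[OF V(1)] by simp
    then show ?thesis using self_mem_line[OF V(1)] by blast
  qed
  show ?thesis
    using lines_meet_unique[OF Y(1) Z(1) Z(3)[symmetric]] on Y Z self_mem_line by metis
qed

lemma shift_line_iff:
  "(\<exists>u W. W \<in> B \<and> (+) v ` L = line u W) \<longleftrightarrow> (\<exists>u W. W \<in> B \<and> L = line u W)"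
proof
  assume "\<exists>u W. W \<in> B \<and> (+) v ` L = line u W"
  then obtain u W where W: "W \<in> B" "(+) v ` L = line u W" by blast
  have "L = (+) (- v) ` (+) v ` L" by (simp add: image_image)
  also have "\<dots> = line (u - v) W" unfolding W(2) by (simp add: line_def image_image algebra_simps)
  finally show "\<exists>u W. W \<in> B \<and> L = line u W" using W(1) by blast
next
  assume "\<exists>u W. W \<in> B \<and> L = line u W"
  then obtain u W where W: "W \<in> B" "L = line u W" by blast
  then have "(+) v ` L = line (v + u) W" by (simp add: line_def image_image add.assoc)
  then show "\<exists>u W. W \<in> B \<and> (+) v ` L = line u W" using W(1) by blast
qed

lemma coll_conj_translation:
  assumes "coll g"
  shows "coll (\<lambda>x. g (v + x) - v)"
proof -
  have eq: "(\<lambda>x. g (v + x) - v) = (+) (- v) \<circ> (g \<circ> (+) v)" by (auto simp: fun_eq_iff)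
  have "bij (\<lambda>x. g (v + x) - v)"
    unfolding eq using coll_imp_bij[OF assms] by (intro bij_comp bij_plus)
  moreover have "(\<lambda>x. g (v + x) - v) ` L = (+) (- v) ` g ` (+) v ` L" for L
    unfolding eq by (simp only: image_comp)
  moreover have "(\<exists>u W. W \<in> B \<and> L = line u W) \<longleftrightarrow>
      (\<exists>u W. W \<in> B \<and> (+) (- v) ` g ` (+) v ` L = line u W)" for L
    using assms unfolding coll_def shift_line_iff[of "- v"] by (metis shift_line_iff[of v L])
  ultimately show ?thesis unfolding coll_def by simp
qed

end

text \<open>The assumption \<open>center\<close> says that \<open>g\<close> maps every line parallel to \<open>X\<close> to itself.\<close>
locale axial_collineation = spread +
  fixes g W X
  assumes g: "coll g" and W: "W \<in> B" and X: "X \<in> B"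
    and axis: "\<And>w. w \<in> W \<Longrightarrow> g w = w"
    and center: "\<And>x. g x - x \<in> X"
begin

lemma g_0 [simp]: "g 0 = 0"
  using axis zero_mem[OF W] by simp

lemma image_component: "Z \<in> B \<Longrightarrow> g ` Z = gam g Z"
  using coll_image_line[OF g, of Z 0] by simp

lemma gam_axis: "gam g W = W"
  using image_component[OF W] axis by simp

lemma gam_center: "gam g X = X"
proof -
  have "g ` X \<subseteq> X"
    using add_mem[OF X] center by (metis add.commute diff_add_cancel image_subsetI)
  then show ?thesis
    using image_component[OF X] line_subset_imp_eq[of "gam g X" X 0 0] gam_0[OF g X] X by simp
qed

text \<open>The defect \<open>D\<close> lies in \<open>X\<close>, being a difference of
  displacements \<open>g x - x\<close>. It also lies in a second component: in \<open>W\<close> if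
  \<open>X\<close> differs from \<open>W\<close>, because \<open>line y W\<close> goes to a parallel
  line, and otherwise in the image of the component through \<open>y\<close>. Hence it is 0.\<close>

lemma add_axis:
  assumes w: "w \<in> W"
  shows "g (w + y) = w + g y"
proof (cases "y \<in> W")
  case True
  then show ?thesis using axis add_mem[OF W] w by simp
next
  case False
  define D where "D = g (w + y) - w - g y"
  have "(g (w + y) - (w + y)) - (g y - y) = D" by (simp add: D_def)
  then have DX: "D \<in> X" using diff_mem[OF X center center] by metis
  have "D = 0"
  proof (cases "X = W")
    case False
    have "g (w + y) \<in> g ` line y W" using w by (auto simp: line_def add.commute)
    then have "g (w + y) - g y \<in> W"
      using coll_image_line[OF g W] gam_axis by (simp add: mem_line_iff)
    then have "g (w + y) - g y - w \<in> W" using diff_mem W w by blast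
    moreover have "g (w + y) - g y - w = D" by (simp add: D_def algebra_simps)
    ultimately have "D \<in> W" by simp
    then show ?thesis using unique[OF X W DX] False by blast
  next
    case True
    obtain Y where Y: "Y \<in> B" "y \<in> Y" using cover by blast
    have ne: "gam g Y \<noteq> X"
      using gam_inj[OF g Y(1) X] gam_center Y True False by auto
    have "g (w + y) \<in> g ` line w Y" using Y by (auto simp: line_def)
    then have "g (w + y) - w \<in> gam g Y"
      using coll_image_line[OF g Y(1)] axis[OF w] by (simp add: mem_line_iff)
    moreover have "g y \<in> gam g Y" using image_component[OF Y(1)] Y by blast
    ultimately have "D \<in> gam g Y"
      using diff_mem gam_0[OF g Y(1)] unfolding D_def by blast
    then show ?thesis using unique[OF X _ DX] ne gam_0[OF g Y(1)] by metis
  qed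
  then show ?thesis by (simp add: D_def algebra_simps)
qed

text \<open>On a component \<open>Y\<close> other than the centre the defect lies in
  \<open>X\<close> and in the image of \<open>Y\<close>, so it vanishes again. Since
  \<open>Y\<close> also differs from the axis, all vectors split along \<open>W\<close> and
  \<open>Y\<close>, and \<open>add_axis\<close> handles the parts in \<open>W\<close>.\<close>

lemma additive: "g (x + y) = g x + g y"
proof -
  obtain Y where Y: "Y \<in> B" "Y \<noteq> W" "Y \<noteq> X" using third by blast
  have add_Y: "g (y1 + y2) = g y1 + g y2" if y: "y1 \<in> Y" "y2 \<in> Y" for y1 y2
  proof -
    define D where "D = g (y1 + y2) - g y1 - g y2"
    have "(g (y1 + y2) - (y1 + y2)) - (g y1 - y1) - (g y2 - y2) = D" by (simp add: D_def)
    then have DX: "D \<in> X" using diff_mem[OF X] center by metis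
    have "D \<in> gam g Y"
      unfolding D_def using y add_mem[OF Y(1)] diff_mem gam_0[OF g Y(1)] image_component[OF Y(1)]
      by (metis imageI)
    moreover have "gam g Y \<noteq> X" using gam_inj[OF g Y(1) X] gam_center Y by auto
    ultimately have "D = 0" using unique[OF X _ DX] gam_0[OF g Y(1)] by metis
    then show ?thesis by (simp add: D_def algebra_simps)
  qed
  obtain w1 y1 where 1: "w1 \<in> W" "y1 \<in> Y" "x = w1 + y1"
    using sum[OF W Y(1) Y(2)[symmetric]] by metis
  obtain w2 y2 where 2: "w2 \<in> W" "y2 \<in> Y" "y = w2 + y2"
    using sum[OF W Y(1) Y(2)[symmetric]] by metis
  have "g (x + y) = g ((w1 + w2) + (y1 + y2))" using 1 2 by (simp add: algebra_simps)
  also have "\<dots> = w1 + w2 + (g y1 + g y2)"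
    using add_axis[OF add_mem[OF W 1(1) 2(1)]] add_Y 1 2 by metis
  finally have "g (x + y) = w1 + w2 + (g y1 + g y2)" .
  then show ?thesis using 1 2 add_axis by (simp add: algebra_simps)
qed

text \<open>A fixed point outside \<open>W\<close> and \<open>X\<close> lies on an invariant
  component whose displacements are in its intersection with \<open>X\<close>; so that component is
  fixed pointwise and together with \<open>W\<close> generates everything. A fixed point of
  \<open>X\<close> outside \<open>W\<close> is moved off both by adding a vector of the
  axis.\<close>

lemma fixed_point_on_axis:
  assumes p: "g p = p" and nid: "\<exists>x. g x \<noteq> x"
  shows "p \<in> W"
proof (rule ccontr)
  assume pW: "p \<notin> W"
  have main: False if p: "g p = p" and pW: "p \<notin> W" and pX: "p \<notin> X" for p
  proof -
    obtain P where P: "P \<in> B" "p \<in> P" using cover by blast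
    have "p \<noteq> 0" using pW zero_mem[OF W] by auto
    moreover have "p \<in> gam g P" using image_component[OF P(1)] P p by (metis imageI)
    ultimately have gamP: "gam g P = P" using unique P gam_0[OF g P(1)] by blast
    have "g x = x" if x: "x \<in> P" for x
    proof -
      have "g x \<in> P" using image_component[OF P(1)] gamP x by blast
      then have "g x - x \<in> P" using diff_mem P x by blast
      then show ?thesis using unique[OF P(1) X _ center] P pX by force
    qed
    then have "g x = x" for x
      using sum[OF W P(1), of x] P pW additive axis by metis
    then show False using nid by blast
  qed
  show False
  proof (cases "p \<in> X")
    case True
    obtain w where w: "w \<in> W" "w \<noteq> 0" using nontrivial[OF W] by blast
    have XW: "X \<noteq> W" using True pW by blast
    have "w \<notin> X" using unique[OF W X] w XW by blast
    then have "w + p \<notin> X" using diff_mem[OF X, of "w + p" p] True by auto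
    moreover have "w + p \<notin> W" using diff_mem[OF W, of "w + p" w] w pW by auto
    moreover have "g (w + p) = w + p" using additive axis w p by simp
    ultimately show False using main by blast
  qed (use main p pW in blast)
qed

end

section \<open>Linear algebra in the plane\<close>

definition sc :: "'a::field \<Rightarrow> 'a \<times> 'a \<Rightarrow> 'a \<times> 'a" where
  "sc c v = (c * fst v, c * snd v)"

lemma sc_simps [simp]:
  "sc c 0 = 0" "sc 0 v = 0" "sc 1 v = v" "sc c (sc d v) = sc (c * d) v"
  "sc c v = 0 \<longleftrightarrow> c = 0 \<or> v = 0"
  by (auto simp: sc_def prod_eq_iff)

lemma sc_add_right: "sc c (v + w) = sc c v + sc c w"
  and sc_add_left: "sc (c + d) v = sc c v + sc d v"
  and sc_diff_right: "sc c (v - w) = sc c v - sc c w"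
  and sc_diff_left: "sc (c - d) v = sc c v - sc d v"
  by (auto simp: sc_def prod_eq_iff algebra_simps)

lemma sc_cancel_right: "v \<noteq> 0 \<Longrightarrow> sc c v = sc d v \<longleftrightarrow> c = d"
  by (auto simp: sc_def prod_eq_iff)

lemma sc_cancel_left: "c \<noteq> 0 \<Longrightarrow> sc c v = sc c w \<longleftrightarrow> v = w"
  by (auto simp: sc_def prod_eq_iff)

lemma span1_eq: "span1 v = range (\<lambda>c. sc c v)"
  by (auto simp: span1_def sc_def)

lemma sc_mem_span1 [simp]: "sc c v \<in> span1 v"
  by (simp add: span1_eq)

lemma self_mem_span1 [simp]: "v \<in> span1 v"
  using sc_mem_span1[of 1 v] by simp

lemma zero_mem_span1: "0 \<in> span1 v"
  using sc_mem_span1[of 0 v] unfolding sc_simps(2) .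

lemma span1_eqI: "u \<in> span1 v \<Longrightarrow> u \<noteq> 0 \<Longrightarrow> span1 u = span1 v"
proof -
  assume "u \<in> span1 v" "u \<noteq> 0"
  then obtain c where c: "u = sc c v" "c \<noteq> 0" by (auto simp: span1_eq)
  have "sc d v \<in> span1 u" "sc d u \<in> span1 v" for d
    using c sc_mem_span1[of "d / c" u] by simp_all
  then show ?thesis unfolding span1_eq by blast
qed

lemma card_span1: "v \<noteq> 0 \<Longrightarrow> card (span1 v) = CARD('a)" for v :: "'a::{field,finite} \<times> 'a"
  unfolding span1_eq by (rule card_image) (auto simp: inj_on_def sc_cancel_right)

lemma Dspread_eq: "Dspread = {span1 v | v. v \<noteq> 0}"
  by (simp add: Dspread_def zero_prod_def)

lemma combination_eq_iff:
  assumes "e1 \<noteq> 0" "e2 \<notin> span1 e1"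
  shows "sc x e1 + sc y e2 = sc x' e1 + sc y' e2 \<longleftrightarrow> x = x' \<and> y = y'"
proof
  assume eq: "sc x e1 + sc y e2 = sc x' e1 + sc y' e2"
  then have *: "sc (y - y') e2 = sc (x' - x) e1"
    by (simp add: sc_diff_left algebra_simps)
  have "y = y'"
  proof (rule ccontr)
    assume ne: "y \<noteq> y'"
    have "e2 = sc (inverse (y - y')) (sc (y - y') e2)" using ne by simp
    then have "e2 = sc (inverse (y - y') * (x' - x)) e1" unfolding * by simp
    then show False using assms(2) by (metis sc_mem_span1)
  qed
  then show "x = x' \<and> y = y'" using * assms(1) by simp
qed simp

lemma combination_exists:
  fixes e1 e2 :: "'a::{field,finite} \<times> 'a"
  assumes "e1 \<noteq> 0" "e2 \<notin> span1 e1"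
  obtains x y where "v = sc x e1 + sc y e2"
proof -
  let ?F = "\<lambda>(x, y). sc x e1 + sc y e2"
  have "inj ?F" by (auto simp: inj_def combination_eq_iff[OF assms])
  then have "surj ?F" by (rule finite_UNIV_inj_surj[rotated]) simp
  then obtain p where "v = ?F p" by (metis surjD)
  then show ?thesis using that by (cases p) auto
qed

lemma act_add: "act A (v + w) = act A v + act A w"
  and act_sc: "act A (sc c v) = sc c (act A v)"
  and act_diff: "act A (v - w) = act A v - act A w"
  and act_0 [simp]: "act A 0 = 0"
  and act_one [simp]: "act mat2_one v = v"
  and act_mult: "act (mat2_mult A B) v = act B (act A v)"
  by (auto simp: act_def sc_def mat2_mult_def mat2_one_def prod_eq_iff algebra_simps split: prod.splits)

lemma act_scalar: "act (k, 0, 0, k) v = sc k v"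
  by (simp add: act_def sc_def mult.commute)

lemma mat2_eqI:
  assumes "\<And>v. act A v = act B v"
  shows "A = B"
  using assms[of "(1, 0)"] assms[of "(0, 1)"]
  by (auto simp: act_def split: prod.splits)

lemma act_inj:
  assumes "A \<in> GL2" "act A v = act A w"
  shows "v = w"
proof -
  obtain a b c d where A: "A = (a, b, c, d)" by (cases A)
  have det: "a * d - b * c \<noteq> 0" using assms A by (simp add: GL2_def)
  obtain x y where xy: "v - w = (x, y)" by (cases "v - w")
  have "act A (v - w) = 0" using assms by (simp add: act_diff)
  then have 1: "x * a + y * c = 0" "x * b + y * d = 0"
    by (auto simp: A xy act_def zero_prod_def)
  have "x * (a * d - b * c) = (x * a + y * c) * d - (x * b + y * d) * c"
    by (simp add: algebra_simps)
  moreover have "y * (a * d - b * c) = (x * b + y * d) * a - (x * a + y * c) * b"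
    by (simp add: algebra_simps)
  ultimately have "x = 0" "y = 0" using det 1 by auto
  then have "v - w = 0" using xy by (simp add: zero_prod_def)
  then show ?thesis by simp
qed

lemma act_bij:
  fixes A :: "'a::{field,finite} mat2"
  shows "A \<in> GL2 \<Longrightarrow> bij (act A)"
  by (intro bijI finite_UNIV_inj_surj injI) (auto dest: act_inj)

lemma GL2_if_inj:
  assumes "\<And>v. act A v = 0 \<Longrightarrow> v = 0"
  shows "A \<in> GL2"
proof -
  obtain a b c d where A: "A = (a, b, c, d)" by (cases A)
  have "a * d - b * c \<noteq> 0"
  proof
    assume 0: "a * d - b * c = 0"
    \<comment> \<open>The rows of the adjugate matrix; their images are multiples of the
      determinant.\<close>
    have "act A (d, - b) = 0" "act A (- c, a) = 0"
      using 0 by (auto simp: A act_def zero_prod_def algebra_simps)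
    then have "(d, - b) = 0" "(- c, a) = 0" using assms by auto
    then have "act A (1, 0) = 0" by (simp add: A act_def zero_prod_def)
    then have "(1::'a, 0::'a) = 0" using assms by blast
    then show False by (simp add: zero_prod_def)
  qed
  then show ?thesis by (simp add: GL2_def A)
qed

lemma GL2_mult: "A \<in> GL2 \<Longrightarrow> B \<in> GL2 \<Longrightarrow> mat2_mult A B \<in> GL2"
  by (rule GL2_if_inj) (metis act_0 act_inj act_mult)

lemma linear_eq_act:
  assumes "\<And>v w. g (v + w) = g v + g w" "\<And>c v. g (sc c v) = sc c (g v)"
  obtains A where "g = act A"
proof -
  obtain a b where ab: "g (1, 0) = (a, b)" by (cases "g (1, 0)")
  obtain c d where cd: "g (0, 1) = (c, d)" by (cases "g (0, 1)")
  have "g v = act (a, b, c, d) v" for v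
  proof -
    have "v = sc (fst v) (1, 0) + sc (snd v) (0, 1)" by (simp add: sc_def prod_eq_iff)
    then have "g v = sc (fst v) (g (1, 0)) + sc (snd v) (g (0, 1))"
      using assms by metis
    then show ?thesis by (simp add: ab cd act_def sc_def)
  qed
  then show ?thesis using that by blast
qed

lemma act_image_span1: "act A ` span1 v = span1 (act A v)"
  by (auto simp: span1_eq act_sc image_iff)

section \<open>The spread of a scattered polynomial\<close>

lemma translate_eq: "translate v W = (+) v ` W"
  by (auto simp: translate_def plus_prod_def)

locale scattered_map =
  fixes q n :: nat and f :: "'a::{field,finite} \<Rightarrow> 'a"
  assumes q: "prime_power q" and q3: "q > 3" and n2: "n > 2"
    and card_K: "CARD('a) = q ^ n"
    and f_add: "f (x + y) = f x + f y"
    and f_Fq: "c \<in> Fq q \<Longrightarrow> f (c * x) = c * f x"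
    and scat: "scattered q f"
begin

lemma frob_add: "(x + y) ^ q = x ^ q + y ^ q" for x y :: 'a
  by (rule add_power_prime_power[OF card_K q])

lemma frob_uminus: "(- x) ^ q = - (x ^ q)" for x :: 'a
proof -
  have "(x + (- x)) ^ q = x ^ q + (- x) ^ q" by (rule frob_add)
  then show ?thesis using q3 by (simp add: eq_neg_iff_add_eq_0 add.commute power_0_left)
qed

lemma Fq_0 [simp]: "0 \<in> Fq q" and Fq_1 [simp]: "1 \<in> Fq q"
  using q3 by (auto simp: Fq_def power_0_left)

lemma Fq_divide: "x \<in> Fq q \<Longrightarrow> y \<in> Fq q \<Longrightarrow> x / y \<in> Fq q"
  by (simp add: Fq_def power_divide)

lemma Fq_uminus: "x \<in> Fq q \<Longrightarrow> - x \<in> Fq q" for x :: 'a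
  by (simp add: Fq_def frob_uminus)

lemma card_Fq_q: "card (Fq q :: 'a set) = q"
  using card_Fq[OF card_K] q3 n2 by simp

lemma f_0 [simp]: "f 0 = 0"
  using f_add[of 0 0] by (metis add_0 add_cancel_right_left)

lemma Uf_iff: "u \<in> Uf f \<longleftrightarrow> snd u = f (fst u)"
  by (auto simp: Uf_def prod_eq_iff)

lemma zero_mem_Uf [simp]: "0 \<in> Uf f"
  by (simp add: Uf_iff)

lemma add_mem_Uf: "u \<in> Uf f \<Longrightarrow> v \<in> Uf f \<Longrightarrow> u + v \<in> Uf f"
  by (simp add: Uf_iff f_add)

lemma sc_mem_Uf: "u \<in> Uf f \<Longrightarrow> c \<in> Fq q \<Longrightarrow> sc c u \<in> Uf f"
  by (simp add: Uf_iff sc_def f_Fq)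

lemma diff_mem_Uf: "u \<in> Uf f \<Longrightarrow> v \<in> Uf f \<Longrightarrow> u - v \<in> Uf f"
proof -
  assume "u \<in> Uf f" "v \<in> Uf f"
  then have "u + sc (- 1) v \<in> Uf f"
    by (intro add_mem_Uf sc_mem_Uf Fq_uminus) auto
  moreover have "u + sc (- 1) v = u - v" by (simp add: sc_def prod_eq_iff)
  ultimately show ?thesis by simp
qed

text \<open>The form in which scatteredness is used: an F_{q^n}-line meets U_f in at most an
  F_q-line. If \<open>u\<close> has first coordinate \<open>y\<close>, then \<open>y\<close> and
  \<open>c * y\<close> satisfy the equation of \<open>scattered\<close>, and their dependence
  expresses \<open>c\<close> as a quotient in F_q.\<close>

lemma sc_mem_Uf_imp_Fq:
  assumes u: "u \<in> Uf f" "u \<noteq> 0" "sc c u \<in> Uf f"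
  shows "c \<in> Fq q"
proof -
  obtain y where y: "u = (y, f y)" using u(1) by (auto simp: Uf_def)
  then have y0: "y \<noteq> 0" using u(2) by (auto simp: zero_prod_def)
  have "c * f y = f (c * y)" using u(3) y by (simp add: Uf_iff sc_def)
  then have "(c * y) * f y - y * f (c * y) = 0" by (simp add: algebra_simps flip: \<open>c * f y = f (c * y)\<close>)
  then have "Fq_dependent q y (c * y)" using scat by (auto simp: scattered_def)
  then obtain l m where lm: "l \<in> Fq q" "m \<in> Fq q" "l \<noteq> 0 \<or> m \<noteq> 0" "l * y + m * (c * y) = 0"
    by (auto simp: Fq_dependent_def)
  then have "(l + m * c) * y = 0" by (simp add: algebra_simps)
  then have 1: "l + m * c = 0" using y0 by simp
  then have "m \<noteq> 0" using lm(3) by auto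
  then have "c = - l / m" using 1 by (simp add: field_simps eq_neg_iff_add_eq_0)
  then show ?thesis using lm Fq_divide Fq_uminus by metis
qed

definition hU :: "'a \<Rightarrow> ('a \<times> 'a) set" where
  "hU h = sc h ` Uf f"

lemma hU_eq: "hU h = {(h * x, h * f x) | x. True}"
  unfolding hU_def Uf_def sc_def by force

lemma Bf_eq: "Bf f = (Dspread - Lf f) \<union> {hU h | h. h \<noteq> 0}"
  by (simp add: Bf_def hU_eq)

lemma sc_image_Uf: "c \<in> Fq q \<Longrightarrow> c \<noteq> 0 \<Longrightarrow> sc c ` Uf f = Uf f"
proof (intro equalityI subsetI)
  fix u assume c: "c \<in> Fq q" "c \<noteq> 0" and u: "u \<in> Uf f"
  have "sc (1 / c) u \<in> Uf f" using u c by (intro sc_mem_Uf Fq_divide) auto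
  moreover have "u = sc c (sc (1 / c) u)" using c by simp
  ultimately show "u \<in> sc c ` Uf f" by (rule image_eqI[rotated])
qed (use sc_mem_Uf in blast)

lemma hU_1: "hU 1 = Uf f"
  by (simp add: hU_def)

lemma sc_image_hU: "sc c ` hU h = hU (c * h)"
  by (auto simp: hU_def image_iff)

lemma hU_Fq: "c \<in> Fq q \<Longrightarrow> c \<noteq> 0 \<Longrightarrow> hU (h * c) = hU h"
  unfolding hU_def using sc_image_Uf[of c] by (metis (no_types) hU_def hU_1 sc_image_hU mult.right_neutral)

lemma hU_iff: "h \<noteq> 0 \<Longrightarrow> u \<in> hU h \<longleftrightarrow> sc (1 / h) u \<in> Uf f"
proof
  assume h: "h \<noteq> 0" and "sc (1 / h) u \<in> Uf f"
  then have "sc h (sc (1 / h) u) \<in> hU h" unfolding hU_def by blast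
  then show "u \<in> hU h" using h by simp
qed (auto simp: hU_def)

lemma card_hU: "h \<noteq> 0 \<Longrightarrow> card (hU h) = q ^ n"
proof -
  assume h: "h \<noteq> 0"
  have "hU h = (\<lambda>x. sc h (x, f x)) ` UNIV" by (auto simp: hU_def Uf_def)
  moreover have "inj (\<lambda>x. sc h (x, f x))" using h by (auto simp: inj_def sc_cancel_left)
  ultimately show ?thesis using card_image card_K by metis
qed

lemma sc_mem_hU_imp_Fq:
  assumes "h \<noteq> 0" "u \<in> hU h" "u \<noteq> 0" "sc c u \<in> hU h"
  shows "c \<in> Fq q"
  using sc_mem_Uf_imp_Fq[of "sc (1 / h) u" c] assms by (simp add: hU_iff mult.commute)

text \<open>Dividing \<open>u\<close> by \<open>h\<close> and by \<open>h'\<close> gives two vectors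
  of U_f on one F_{q^n}-line, so \<open>h / h'\<close> lies in F_q, and factors from F_q do not
  change \<open>hU\<close>.\<close>

lemma hU_unique:
  assumes "h \<noteq> 0" "h' \<noteq> 0" "u \<in> hU h" "u \<in> hU h'" "u \<noteq> 0"
  shows "hU h = hU h'"
proof -
  have "h / h' \<in> Fq q"
    using sc_mem_Uf_imp_Fq[of "sc (1 / h) u" "h / h'"] assms by (simp add: hU_iff)
  then have "hU (h' * (h / h')) = hU h'" using assms by (intro hU_Fq) auto
  then show ?thesis using assms by simp
qed

lemma span1_mem_Lf_iff:
  assumes "u \<noteq> 0"
  shows "span1 u \<in> Lf f \<longleftrightarrow> (\<exists>h. h \<noteq> 0 \<and> u \<in> hU h)"
proof
  assume "span1 u \<in> Lf f"
  then obtain x where x: "span1 u = span1 (x, f x)" by (auto simp: Lf_def)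
  have "u \<in> span1 (x, f x)" unfolding x[symmetric] by simp
  then obtain h where "u = sc h (x, f x)" by (auto simp: span1_eq)
  then show "\<exists>h. h \<noteq> 0 \<and> u \<in> hU h" using assms by (auto simp: hU_def Uf_def)
next
  assume "\<exists>h. h \<noteq> 0 \<and> u \<in> hU h"
  then obtain h x where h: "h \<noteq> 0" "u = sc h (x, f x)" by (auto simp: hU_def Uf_def)
  have "x \<noteq> 0" using assms h by (auto simp: zero_prod_def sc_def)
  moreover have "span1 u = span1 (x, f x)" using h assms by (intro span1_eqI) auto
  ultimately show "span1 u \<in> Lf f" by (auto simp: Lf_def)
qed

lemma Bf_cases:
  assumes "W \<in> Bf f"
  obtains (D) v where "v \<noteq> 0" "W = span1 v" "span1 v \<notin> Lf f" "W \<in> Dspread"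
    | (U) h where "h \<noteq> 0" "W = hU h"
proof -
  consider "W \<in> Dspread" "W \<notin> Lf f" | h where "h \<noteq> 0" "W = hU h"
    using assms unfolding Bf_eq by blast
  then show ?thesis
  proof cases
    case 1
    then obtain v where "W = span1 v" "v \<noteq> 0" unfolding Dspread_eq by blast
    then show ?thesis using D 1 by simp
  qed (rule U)
qed

lemma card_component: "W \<in> Bf f \<Longrightarrow> card W = q ^ n"
  by (erule Bf_cases) (simp_all add: card_hU card_span1 card_K)

lemma component_unique:
  assumes "W \<in> Bf f" "Z \<in> Bf f" "v \<in> W" "v \<in> Z" "v \<noteq> 0"
  shows "W = Z"
proof -
  have D: "span1 w = span1 v" if "v \<in> span1 w" for w
    using that assms(5) by (simp add: span1_eqI)
  show ?thesis
    using assms(1)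
  proof (cases rule: Bf_cases)
    case (D w)
    then have W: "W = span1 v" "span1 v \<notin> Lf f"
      using span1_eqI[of v w] assms(3,5) by simp_all
    show ?thesis using assms(2)
    proof (cases rule: Bf_cases)
      case (D z)
      then show ?thesis using W span1_eqI[of v z] assms(4,5) by simp
    next
      case (U h)
      then show ?thesis using W span1_mem_Lf_iff assms by blast
    qed
  next
    case (U h)
    show ?thesis using assms(2)
    proof (cases rule: Bf_cases)
      case (D z)
      then have "span1 v \<notin> Lf f" using span1_eqI[of v z] assms(4,5) by simp
      then show ?thesis using U span1_mem_Lf_iff assms by blast
    next
      case U': (U h')
      then show ?thesis using U hU_unique assms by blast
    qed
  qed
qed

lemma component_diff:
  assumes "W \<in> Bf f" "x \<in> W" "y \<in> W"
  shows "x - y \<in> W"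
  using assms(1)
proof (cases rule: Bf_cases)
  case (D v)
  then obtain c d where "x = sc c v" "y = sc d v" using assms by (auto simp: span1_eq)
  then show ?thesis using D by (metis sc_diff_left sc_mem_span1)
next
  case (U h)
  then show ?thesis using assms diff_mem_Uf by (auto simp: hU_iff sc_diff_right)
qed

lemma component_zero:
  assumes "W \<in> Bf f"
  shows "0 \<in> W"
  using assms
proof (cases rule: Bf_cases)
  case (D v)
  show ?thesis unfolding D(2) by (rule zero_mem_span1)
next
  case (U h)
  then show ?thesis unfolding U(2) hU_def using zero_mem_Uf sc_simps(1)[of h] by (metis imageI)
qed

lemma component_cover: "\<exists>W\<in>Bf f. v \<in> W"
proof (cases "v = 0")
  case True
  have "hU 1 \<in> Bf f" unfolding Bf_eq by (rule UnI2) (auto intro: exI[of _ 1])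
  then show ?thesis using component_zero True by blast
next
  case False
  show ?thesis
  proof (cases "span1 v \<in> Lf f")
    case True
    then show ?thesis using span1_mem_Lf_iff[OF False] unfolding Bf_eq by blast
  next
    case notL: False
    then have "span1 v \<in> Bf f" using False unfolding Bf_eq Dspread_eq by blast
    then show ?thesis by (meson self_mem_span1)
  qed
qed

lemma qn_ge: "q ^ n \<ge> 64"
proof -
  have "(4::nat) ^ 3 \<le> q ^ 3" using q3 by (intro power_mono) auto
  also have "\<dots> \<le> q ^ n" using q3 n2 by (intro power_increasing) auto
  finally show ?thesis by simp
qed

lemma card_plane: "CARD('a \<times> 'a) = q ^ n * q ^ n"
  by (simp add: card_K)

text \<open>Addition is injective on \<open>W \<times> Z\<close>, since the components share only 0;
  both have q^n elements, so the sums fill the plane.\<close>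

lemma component_sum:
  assumes "W \<in> Bf f" "Z \<in> Bf f" "W \<noteq> Z"
  shows "\<exists>w\<in>W. \<exists>z\<in>Z. v = w + z"
proof -
  let ?F = "\<lambda>(w, z). w + z"
  have "inj_on ?F (W \<times> Z)"
  proof (rule inj_onI)
    fix p p' assume *: "p \<in> W \<times> Z" "p' \<in> W \<times> Z" "?F p = ?F p'"
    obtain w z w' z' where p: "p = (w, z)" "p' = (w', z')" by (cases p, cases p')
    have d: "w - w' = z' - z" using *(3) p by (simp add: algebra_simps)
    have "w - w' \<in> W" using component_diff[OF assms(1)] * p by blast
    moreover have "w - w' \<in> Z" unfolding d using component_diff[OF assms(2)] * p by blast
    ultimately have "w - w' = 0" using component_unique[OF assms(1,2)] assms(3) by blast
    then show "p = p'" using d p by simp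
  qed
  then have "card (?F ` (W \<times> Z)) = card W * card Z"
    by (simp add: card_image card_cartesian_product)
  also have "\<dots> = CARD('a \<times> 'a)"
    using card_component assms card_plane by simp
  finally have "?F ` (W \<times> Z) = UNIV"
    by (intro card_subset_eq) auto
  then have "v \<in> ?F ` (W \<times> Z)" by simp
  then show ?thesis by auto
qed

lemma component_third: "\<exists>Y\<in>Bf f. Y \<noteq> W \<and> Y \<noteq> Z"
proof (rule ccontr)
  assume "\<not> ?thesis"
  then have sub: "Bf f \<subseteq> {W, Z}" by blast
  have "UNIV \<subseteq> \<Union>(Bf f)" using component_cover by auto
  then have "CARD('a \<times> 'a) \<le> card (\<Union>(Bf f))" by (intro card_mono) auto
  also have "\<dots> \<le> (\<Sum>V\<in>Bf f. card V)"
    using sub by (intro card_Union_le_sum_card)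
  also have "\<dots> \<le> (\<Sum>V\<in>Bf f. q ^ n)"
    using card_component by (intro sum_mono) auto
  also have "\<dots> = card (Bf f) * q ^ n" by simp
  also have "\<dots> \<le> 2 * q ^ n"
    using card_mono[OF _ sub] by (intro mult_right_mono) (auto simp: card_insert_if split: if_splits)
  finally have "q ^ n * q ^ n \<le> 2 * q ^ n" using card_plane by simp
  then show False using mult_le_mono1[OF qn_ge, of "q ^ n"] qn_ge by linarith
qed

lemma component_nontrivial:
  assumes "W \<in> Bf f"
  shows "\<exists>w\<in>W. w \<noteq> 0"
proof (rule ccontr)
  assume "\<not> ?thesis"
  then have "card W \<le> card {0 :: 'a \<times> 'a}" by (intro card_mono) auto
  then show False using card_component[OF assms] qn_ge by simp
qed

sublocale S: spread "Bf f"
  by standard (rule component_zero component_diff component_nontrivial component_cover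
      component_unique component_sum component_third; assumption?)+

lemma translate_line: "translate v W = S.line v W"
  by (simp add: translate_eq S.line_def)

lemma collineation_iff: "collineation f g \<longleftrightarrow> S.coll g"
  unfolding collineation_def S.coll_def lines_def translate_line mem_Collect_eq by metis

lemma dir_line: "W \<in> Bf f \<Longrightarrow> dir f (S.line v W) = W"
  unfolding dir_def translate_line by (rule the_equality) (blast dest: S.line_inj)+

lemma ext_Inr: "S.coll g \<Longrightarrow> W \<in> Bf f \<Longrightarrow> ext f g (Inr W) = Inr (S.gam g W)"
  using S.gam_0[of g W] dir_line by (simp add: ext_def)


section \<open>Reduction of affine central collineations to semilinear maps\<close>

lemma proj_inc_Inr: "X \<in> Bf f \<Longrightarrow> W \<in> Bf f \<Longrightarrow> proj_inc (Inr X) (Some (S.line v W)) \<longleftrightarrow> X = W"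
proof
  assume "X \<in> Bf f" "W \<in> Bf f" "proj_inc (Inr X) (Some (S.line v W))"
  then obtain u where "S.line v W = S.line u X" by (auto simp: proj_inc_def translate_line)
  then show "X = W" using S.line_inj \<open>X \<in> Bf f\<close> \<open>W \<in> Bf f\<close> by metis
next
  assume "X = W"
  moreover have "\<exists>u. S.line v W = S.line u W" by blast
  ultimately show "proj_inc (Inr X) (Some (S.line v W))" by (simp add: proj_inc_def translate_line)
qed

text \<open>The definition of a central collineation admits an affine point as centre. In that case
  every direction would be fixed and \<open>g\<close> would be the identity; so the centre is a
  component \<open>X\<close>, and conjugation by a translation carries the axis to the
  origin.\<close>

lemma affine_central_normal_form:
  assumes "affine_central f g ax c"
  obtains v W X where "W \<in> Bf f" "X \<in> Bf f" "ax = S.line v W" "c = Inr X"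
    "axial_collineation (Bf f) (\<lambda>x. g (v + x) - v) W X" "\<exists>x. g (v + x) - v \<noteq> x"
proof -
  have g: "S.coll g" and ax: "ax \<in> lines f"
    and cc: "central_collineation (proj_points f) (proj_lines f) proj_inc (ext f g) (Some ax) c"
    using assms by (auto simp: affine_central_def collineation_iff)
  obtain v W where W: "W \<in> Bf f" "ax = S.line v W"
    using ax by (auto simp: lines_def translate_line)
  have axis: "g x = x" if "x \<in> S.line v W" for x
  proof -
    have "ext f g (Inl x) = Inl x"
      using cc that W by (auto simp: central_collineation_def proj_points_def proj_inc_def)
    then show ?thesis by (simp add: ext_def)
  qed
  have nid: "\<exists>x. g x \<noteq> x"
  proof (rule ccontr)
    assume "\<not> ?thesis"
    then have gid: "g = id" by auto
    have "ext f g p = p" if "p \<in> proj_points f" for p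
      using that dir_line[of _ 0] by (auto simp: proj_points_def ext_def gid)
    then show False using cc by (auto simp: central_collineation_def)
  qed
  have lines_c: "g x \<in> S.line u Z"
    if Z: "Z \<in> Bf f" "proj_inc c (Some (S.line u Z))" "x \<in> S.line u Z" for u Z x
  proof -
    have "Some (S.line u Z) \<in> proj_lines f"
      using Z unfolding proj_lines_def lines_def translate_line by blast
    then have "ext f g ` {p \<in> proj_points f. proj_inc p (Some (S.line u Z))}
        = {p \<in> proj_points f. proj_inc p (Some (S.line u Z))}"
      using cc Z(2) by (auto simp: central_collineation_def)
    moreover have "Inl x \<in> {p \<in> proj_points f. proj_inc p (Some (S.line u Z))}"
      using Z(3) by (simp add: proj_points_def proj_inc_def)
    ultimately have "ext f g (Inl x) \<in> {p \<in> proj_points f. proj_inc p (Some (S.line u Z))}"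
      by blast
    then show ?thesis by (simp add: ext_def proj_inc_def)
  qed
  have "c \<in> proj_points f" using cc by (simp add: central_collineation_def)
  then consider p where "c = Inl p" | X where "c = Inr X" "X \<in> Bf f"
    by (auto simp: proj_points_def)
  then show ?thesis
  proof cases
    case 1
    have "S.gam g Z = Z" if Z: "Z \<in> Bf f" for Z
    proof -
      have "g ` S.line p Z \<subseteq> S.line p Z"
        using lines_c[OF Z, of p] 1 S.self_mem_line[OF Z] by (auto simp: proj_inc_def)
      then show ?thesis
        using S.coll_image_line[OF g Z] S.line_subset_imp_eq S.gam_0[OF g Z] Z by metis
    qed
    then have "g x = x" for x
      using S.id_if_all_directions_fixed[OF g W(1) axis] by blast
    then show ?thesis using nid by blast
  next
    case (2 X)
    have "g x - x \<in> X" for x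
      using lines_c[OF 2(2), of x x] S.self_mem_line[OF 2(2)] proj_inc_Inr[OF 2(2) 2(2)] 2(1)
      by (simp add: S.mem_line_iff)
    then have cen: "g (v + x) - v - x \<in> X" for x
      by (metis diff_diff_add)
    have "axial_collineation (Bf f) (\<lambda>x. g (v + x) - v) W X"
    proof
      show "S.coll (\<lambda>x. g (v + x) - v)" by (rule S.coll_conj_translation[OF g])
      show "g (v + w) - v = w" if "w \<in> W" for w
        using axis[of "v + w"] that by (simp add: S.mem_line_iff)
    qed (use W 2 cen in auto)
    moreover have "\<exists>x. g (v + x) - v \<noteq> x"
    proof -
      obtain y where "g y \<noteq> y" using nid by blast
      then have "g (v + (y - v)) - v \<noteq> y - v" by simp
      then show ?thesis by blast
    qed
    ultimately show ?thesis using that W 2 by blast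
  qed
qed

section \<open>Counting Desarguesian lines with Desarguesian image\<close>

lemma card_Lf_le: "3 * card (Lf f) < q ^ n"
proof -
  have Lf: "Lf f = (\<lambda>x. span1 (x, f x)) ` (UNIV - {0})" by (auto simp: Lf_def)
  have "(q - 1) * card (Lf f) \<le> card (UNIV - {0::'a})"
    unfolding Lf
  proof (rule card_le_card_image_mult)
    fix x :: 'a assume x: "x \<in> UNIV - {0}"
    have "q - 1 = card ((\<lambda>c. c * x) ` (Fq q - {0}))"
      using x card_Fq_q by (subst card_image) (auto simp: inj_on_def card_Diff_singleton)
    also have "\<dots> \<le> card {y \<in> UNIV - {0}. span1 (y, f y) = span1 (x, f x)}"
    proof (rule card_mono)
      show "(\<lambda>c. c * x) ` (Fq q - {0}) \<subseteq> {y \<in> UNIV - {0}. span1 (y, f y) = span1 (x, f x)}"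
      proof (rule image_subsetI)
        fix c :: 'a assume "c \<in> Fq q - {0}"
        then have c: "c \<in> Fq q" "c \<noteq> 0" by auto
        have "(c * x, f (c * x)) = sc c (x, f x)" using f_Fq[OF c(1)] by (simp add: sc_def)
        then have "span1 (c * x, f (c * x)) = span1 (x, f x)"
          using c x by (intro span1_eqI) (auto simp: zero_prod_def)
        then show "c * x \<in> {y \<in> UNIV - {0}. span1 (y, f y) = span1 (x, f x)}"
          using c x by simp
      qed
    qed simp
    finally show "q - 1 \<le> card {y \<in> UNIV - {0}. span1 (y, f y) = span1 (x, f x)}" .
  qed simp
  then have "(q - 1) * card (Lf f) < q ^ n"
    using qn_ge by (simp add: card_Diff_singleton card_K)
  moreover have "3 * card (Lf f) \<le> (q - 1) * card (Lf f)"
    using q3 by (intro mult_le_mono1) simp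
  ultimately show ?thesis by linarith
qed

lemma card_hUs_le: "3 * card {hU h | h. h \<noteq> 0} < q ^ n"
proof -
  have eq: "{hU h | h. h \<noteq> 0} = hU ` (UNIV - {0})" by auto
  have "(q - 1) * card (hU ` (UNIV - {0})) \<le> card (UNIV - {0::'a})"
  proof (rule card_le_card_image_mult)
    fix h :: 'a assume h: "h \<in> UNIV - {0}"
    have "q - 1 = card ((\<lambda>c. h * c) ` (Fq q - {0}))"
      using h card_Fq_q by (subst card_image) (auto simp: inj_on_def card_Diff_singleton)
    also have "\<dots> \<le> card {y \<in> UNIV - {0}. hU y = hU h}"
      using h hU_Fq by (intro card_mono) auto
    finally show "q - 1 \<le> card {y \<in> UNIV - {0}. hU y = hU h}" .
  qed simp
  then have "(q - 1) * card (hU ` (UNIV - {0})) < q ^ n"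
    using qn_ge by (simp add: card_Diff_singleton card_K)
  moreover have "3 * card (hU ` (UNIV - {0})) \<le> (q - 1) * card (hU ` (UNIV - {0}))"
    using q3 by (intro mult_le_mono1) simp
  ultimately show ?thesis unfolding eq by linarith
qed

lemma card_Dspread_ge: "q ^ n + 1 \<le> card (Dspread :: ('a \<times> 'a) set set)"
proof -
  let ?m = "\<lambda>m. span1 (1::'a, m)"
  have inj: "inj ?m"
  proof (rule injI)
    fix m m' :: 'a assume "?m m = ?m m'"
    then have "(1, m) \<in> ?m m'" by (metis self_mem_span1)
    then show "m = m'" by (auto simp: span1_def)
  qed
  have "span1 (0::'a, 1::'a) \<notin> range ?m"
  proof
    assume "span1 (0::'a, 1::'a) \<in> range ?m"
    then obtain m where "span1 (0::'a, 1::'a) = ?m m" by blast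
    then have "(1, m) \<in> span1 (0::'a, 1)" by (metis self_mem_span1)
    then show False by (auto simp: span1_def)
  qed
  then have "card (insert (span1 (0, 1)) (range ?m)) = Suc (q ^ n)"
    using card_image[OF inj] card_K by simp
  moreover have "insert (span1 (0, 1)) (range ?m) \<subseteq> Dspread"
  proof -
    have "span1 v \<in> Dspread" if "v \<noteq> (0, 0)" for v :: "'a \<times> 'a"
      using that unfolding Dspread_def by blast
    then show ?thesis by (intro insert_subsetI image_subsetI) auto
  qed
  ultimately show ?thesis
    using card_mono[of Dspread "insert (span1 (0, 1)) (range ?m)"] by simp
qed

definition desarg :: "('a \<times> 'a \<Rightarrow> 'a \<times> 'a) \<Rightarrow> ('a \<times> 'a) set set" where
  "desarg g = {W \<in> Dspread. g ` W \<in> Dspread}"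

text \<open>A line of \<open>Dspread\<close> is lost only if it lies in \<open>Lf f\<close> or is a
  component sent to some \<open>hU h\<close>. Each kind numbers at most (q^n - 1)/3, out of at least
  q^n + 1 lines: 3(q^n + 1) - 2(q^n - 1) = q^n + 5.\<close>

lemma card_desarg:
  assumes g: "S.coll g" and g0: "g 0 = 0"
  shows "q ^ n + 5 \<le> 3 * card (desarg g)"
proof -
  let ?E = "{W \<in> Dspread - Lf f. g ` W \<notin> Dspread}"
  let ?H = "{hU h | h. h \<noteq> 0}"
  have "(`) g ` ?E \<subseteq> ?H"
  proof clarify
    fix W :: "('a \<times> 'a) set" assume W: "W \<in> Dspread" "W \<notin> Lf f" "g ` W \<notin> Dspread"
    then have WB: "W \<in> Bf f" by (simp add: Bf_eq)
    have "g ` W = S.gam g W" using S.gam_0(2)[OF g WB] g0 by simp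
    then have "g ` W \<in> Bf f" using S.gam_0(1)[OF g WB] by simp
    then show "\<exists>h. g ` W = hU h \<and> h \<noteq> 0" using W(3) unfolding Bf_eq by blast
  qed
  moreover have "inj_on ((`) g) ?E"
    using S.coll_imp_bij[OF g] by (auto simp: inj_on_def bij_def inj_image_eq_iff)
  ultimately have E: "card ?E \<le> card ?H"
    by (intro card_inj_on_le[of "(`) g"]) auto
  have "Dspread \<subseteq> desarg g \<union> (Lf f \<union> ?E)" by (auto simp: desarg_def)
  then have "card (Dspread :: ('a \<times> 'a) set set) \<le> card (desarg g \<union> (Lf f \<union> ?E))"
    by (intro card_mono) auto
  also have "\<dots> \<le> card (desarg g) + (card (Lf f) + card ?E)"
    by (meson add_le_mono card_Un_le le_refl le_trans)
  finally show ?thesis using card_Dspread_ge card_Lf_le card_hUs_le E by linarith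
qed

text \<open>As the image of the line is again an F_{q^n}-line, \<open>g\<close> acts on it through a
  function of scalars. That this function is multiplicative and common to all lines is shown in
  \<open>coll_semilinear\<close>.\<close>

lemma desarg_scalar:
  assumes add: "\<And>x y. g (x + y) = g x + g y" and inj: "inj g" and W: "span1 e \<in> desarg g" "e \<noteq> 0"
  shows "\<exists>s. \<forall>k. g (sc k e) = sc (s k) (g e)"
proof -
  obtain w where w: "g ` span1 e = span1 w" "w \<noteq> 0"
    using W by (auto simp: desarg_def Dspread_eq)
  have "g 0 = 0" using add[of 0 0] by simp
  then have "g e \<noteq> 0" using inj W(2) by (metis injD)
  moreover have "g e \<in> span1 w" unfolding w(1)[symmetric] by simp
  ultimately have eq: "g ` span1 e = span1 (g e)" using w span1_eqI by metis
  have "\<exists>l. g (sc k e) = sc l (g e)" for k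
  proof -
    have "g (sc k e) \<in> span1 (g e)" unfolding eq[symmetric] by simp
    then show ?thesis by (auto simp: span1_eq)
  qed
  then show ?thesis by metis
qed

text \<open>
  More than a third of the components of \<open>Dspread\<close> have their image in \<open>Dspread\<close>.  Three of
  them yield the companion map \<open>\<sigma>\<close>; the others show that \<open>\<sigma>\<close> is multiplicative on a set too large
  to be a proper subfield.
\<close>
lemma coll_semilinear:
  assumes g: "S.coll g" and add: "\<And>x y. g (x + y) = g x + g y"
  obtains \<sigma> where "\<And>k v. g (sc k v) = sc (\<sigma> k) (g v)"
proof -
  have g0: "g 0 = 0" using add[of 0 0] by simp
  have inj: "inj g" using S.coll_imp_bij[OF g] by (simp add: bij_def)
  let ?T = "desarg g"
  have cT: "q ^ n + 5 \<le> 3 * card ?T" by (rule card_desarg[OF g g0])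
  then have "3 \<le> card ?T" using qn_ge by simp
  then obtain R where "R \<subseteq> ?T" "card R = 3" by (meson obtain_subset_with_card_n)
  then obtain W1 W2 W3 where W: "W1 \<in> ?T" "W2 \<in> ?T" "W3 \<in> ?T" "W1 \<noteq> W2" "W1 \<noteq> W3" "W2 \<noteq> W3"
    by (auto simp: card_3_iff)
  have D: "\<exists>a. V = span1 a \<and> a \<noteq> 0" if "V \<in> ?T" for V
    using that unfolding desarg_def Dspread_eq by blast
  obtain a1 a2 a3 where a: "W1 = span1 a1" "a1 \<noteq> 0" "W2 = span1 a2" "a2 \<noteq> 0" "W3 = span1 a3" "a3 \<noteq> 0"
    using D[OF W(1)] D[OF W(2)] D[OF W(3)] by blast
  have "a2 \<notin> span1 a1" using a W span1_eqI by blast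
  then obtain x y where xy: "a3 = sc x a1 + sc y a2"
    using combination_exists a(2) by metis
  have x0: "x \<noteq> 0"
  proof
    assume "x = 0"
    then have "a3 \<in> span1 a2" using xy by simp
    then show False using a W span1_eqI by blast
  qed
  have y0: "y \<noteq> 0"
  proof
    assume "y = 0"
    then have "a3 \<in> span1 a1" using xy by simp
    then show False using a W span1_eqI by blast
  qed
  \<comment> \<open>Generators are rescaled so that the third line is spanned by
    \<open>e1 + e2\<close>; comparing coefficients then forces the three scalar functions to
    coincide.\<close>
  define e1 where "e1 = sc x a1"
  define e2 where "e2 = sc y a2"
  have e: "e1 \<noteq> 0" "e2 \<noteq> 0" using a x0 y0 by (auto simp: e1_def e2_def)
  have W1: "W1 = span1 e1" using a e span1_eqI[of e1 a1] by (simp add: e1_def)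
  have W2: "W2 = span1 e2" using a e span1_eqI[of e2 a2] by (simp add: e2_def)
  have W3: "W3 = span1 (e1 + e2)" using a xy by (simp add: e1_def e2_def)
  have e12: "e2 \<notin> span1 e1" using W1 W2 W e span1_eqI by blast
  have e3: "e1 + e2 \<noteq> 0" using a xy by (simp add: e1_def e2_def)
  obtain s1 where s1: "\<And>k. g (sc k e1) = sc (s1 k) (g e1)"
    using desarg_scalar[OF add inj] W W1 e by metis
  obtain s2 where s2: "\<And>k. g (sc k e2) = sc (s2 k) (g e2)"
    using desarg_scalar[OF add inj] W W2 e by metis
  obtain s3 where s3: "\<And>k. g (sc k (e1 + e2)) = sc (s3 k) (g (e1 + e2))"
    using desarg_scalar[OF add inj] W W3 e3 by metis
  have ge1: "g e1 \<noteq> 0" using g0 e inj by (metis injD)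
  have ge2: "g e2 \<notin> span1 (g e1)"
  proof
    assume *: "g e2 \<in> span1 (g e1)"
    have "g ` W1 \<in> Dspread" using W by (simp add: desarg_def)
    then obtain w where w: "g ` W1 = span1 w" by (auto simp: Dspread_eq)
    have "g e1 \<in> g ` W1" using W1 by simp
    then have "g ` W1 = span1 (g e1)" using w ge1 span1_eqI by blast
    then have "g e2 \<in> g ` W1" using * by simp
    then have "e2 \<in> W1" using inj by (simp add: inj_image_mem_iff)
    then show False using e12 W1 by simp
  qed
  note indep = combination_eq_iff[OF ge1 ge2]
  have s123: "s1 k = s3 k \<and> s2 k = s3 k" for k
  proof -
    have "sc (s1 k) (g e1) + sc (s2 k) (g e2) = sc (s3 k) (g e1) + sc (s3 k) (g e2)"
      using s3[of k] by (simp add: sc_add_right add s1 s2)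
    then show ?thesis by (simp add: indep)
  qed
  define \<sigma> where "\<sigma> = s1"
  have \<sigma>1: "g (sc k e1) = sc (\<sigma> k) (g e1)" and \<sigma>2: "g (sc k e2) = sc (\<sigma> k) (g e2)" for k
    using s1 s2 s123 by (auto simp: \<sigma>_def)
  have \<sigma>_add: "\<sigma> (k + l) = \<sigma> k + \<sigma> l" for k l
  proof -
    have "sc (\<sigma> (k + l)) (g e1) = sc (\<sigma> k + \<sigma> l) (g e1)"
      using \<sigma>1[of "k + l"] by (simp add: sc_add_left add \<sigma>1)
    then show ?thesis using ge1 by (simp add: sc_cancel_right)
  qed
  have \<sigma>_0: "\<sigma> 0 = 0" using \<sigma>_add[of 0 0] by (metis add_0 add_cancel_right_left)
  have \<sigma>_diff: "\<sigma> (k - l) = \<sigma> k - \<sigma> l" for k l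
    using \<sigma>_add[of "k - l" l] by simp
  have \<sigma>_1: "\<sigma> 1 = 1"
    using \<sigma>1[of 1] ge1 sc_cancel_right[OF ge1, of "\<sigma> 1" 1] by simp
  have \<sigma>_nz: "\<sigma> k \<noteq> 0" if "k \<noteq> 0" for k
  proof
    assume "\<sigma> k = 0"
    then have "g (sc k e1) = g 0" using \<sigma>1 g0 by simp
    then have "sc k e1 = 0" using inj by (meson injD)
    then show False using that e by simp
  qed
  \<comment> \<open>The set of all \<open>m\<close> that behave multiplicatively against every
    \<open>k\<close>; it is closed under differences and quotients, and the slope \<open>m\<close>
    of each line \<open>span1 (e1 + sc m e2)\<close> in \<open>?T\<close> belongs to it.\<close>
  define M where "M = {m. \<forall>k. \<sigma> (k * m) = \<sigma> k * \<sigma> m}"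
  have M_mem: "m \<in> M" if m: "span1 (e1 + sc m e2) \<in> ?T" for m
  proof -
    have "e1 + sc m e2 \<noteq> 0"
      using combination_eq_iff[OF e(1) e12, of 1 m 0 0] by simp
    then obtain t where t: "\<And>k. g (sc k (e1 + sc m e2)) = sc (t k) (g (e1 + sc m e2))"
      using desarg_scalar[OF add inj m] by metis
    have "sc (\<sigma> k) (g e1) + sc (\<sigma> (k * m)) (g e2) = sc (t k) (g e1) + sc (t k * \<sigma> m) (g e2)" for k
      using t[of k] by (simp add: sc_add_right add \<sigma>1 \<sigma>2)
    then have "\<sigma> (k * m) = \<sigma> k * \<sigma> m" for k unfolding indep by metis
    then show ?thesis by (simp add: M_def)
  qed
  \<comment> \<open>Every line except \<open>W2\<close> has a slope, so \<open>M\<close> has at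
    least \<open>card ?T - 1\<close> elements and 3 |M| is at least q^n + 5 - 3.\<close>
  have "?T - {W2} \<subseteq> (\<lambda>m. span1 (e1 + sc m e2)) ` M"
  proof
    fix V assume V: "V \<in> ?T - {W2}"
    then obtain v where v: "V = span1 v" "v \<noteq> 0" using D by blast
    obtain a b where ab: "v = sc a e1 + sc b e2" using combination_exists e(1) e12 by metis
    have "a \<noteq> 0"
    proof
      assume "a = 0"
      then have "v \<in> span1 e2" using ab by simp
      then show False using V v W2 span1_eqI by blast
    qed
    then have "v = sc a (e1 + sc (b / a) e2)" using ab by (simp add: sc_add_right)
    moreover have "sc (inverse a) v = e1 + sc (b / a) e2"
      using \<open>a \<noteq> 0\<close> calculation by simp
    ultimately have "V = span1 (e1 + sc (b / a) e2)"
      using v \<open>a \<noteq> 0\<close> span1_eqI[of "e1 + sc (b / a) e2" v]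
      by (metis sc_mem_span1 sc_simps(1))
    then show "V \<in> (\<lambda>m. span1 (e1 + sc m e2)) ` M"
      using M_mem[of "b / a"] V by blast
  qed
  then have "card (?T - {W2}) \<le> card ((\<lambda>m. span1 (e1 + sc m e2)) ` M)"
    by (intro card_mono) auto
  also have "\<dots> \<le> card M" by (intro card_image_le) simp
  finally have cM: "q ^ n + 2 \<le> 3 * card M"
    using cT W by (simp add: card_Diff_singleton)
  have "M = UNIV"
  proof (rule subfield_eq_UNIV)
    show "x - y \<in> M" if "x \<in> M" "y \<in> M" for x y
      using that by (simp add: M_def \<sigma>_diff right_diff_distrib)
    show "x / y \<in> M" if xy: "x \<in> M" "y \<in> M" for x y
    proof (cases "y = 0")
      case True
      then show ?thesis by (simp add: M_def \<sigma>_0)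
    next
      case False
      have inv: "\<sigma> (k / y) = \<sigma> k / \<sigma> y" for k
      proof -
        have "\<sigma> (k / y * y) = \<sigma> (k / y) * \<sigma> y" using xy unfolding M_def by blast
        moreover have "k / y * y = k" using False by simp
        ultimately have "\<sigma> k = \<sigma> (k / y) * \<sigma> y" by simp
        then show ?thesis using \<sigma>_nz[OF False] by simp
      qed
      have "\<sigma> (k * (x / y)) = \<sigma> k * \<sigma> (x / y)" for k
        using inv[of "k * x"] inv[of x] xy by (simp add: M_def)
      then show ?thesis by (simp add: M_def)
    qed
    \<comment> \<open>Here 9 |M|^2 is at least (q^n + 2)^2, and q^n \<ge> 64 makes this larger than
      9 q^n.\<close>
    have "(q ^ n + 2) * (q ^ n + 2) \<le> (3 * card M) * (3 * card M)"
      using cM by (intro mult_le_mono) auto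
    moreover have "64 * (q ^ n) \<le> q ^ n * q ^ n" using qn_ge by (intro mult_le_mono1)
    ultimately show "CARD('a) < card M * card M"
      using qn_ge unfolding card_K add_mult_distrib add_mult_distrib2 by linarith
  qed
  then have \<sigma>_mult: "\<sigma> (k * l) = \<sigma> k * \<sigma> l" for k l by (auto simp: M_def)
  have "g (sc k v) = sc (\<sigma> k) (g v)" for k v
  proof -
    obtain a b where "v = sc a e1 + sc b e2" using combination_exists e(1) e12 by metis
    then show ?thesis by (simp add: sc_add_right add \<sigma>1 \<sigma>2 \<sigma>_mult)
  qed
  then show ?thesis using that by blast
qed

lemma CollGL_iff: "A \<in> CollGL f \<longleftrightarrow> A \<in> GL2 \<and> S.coll (act A)"
  by (simp add: CollGL_def collineation_iff)

text \<open>
  If the axis were \<open>hU h\<close>, the fixed field \<open>F\<close> of \<open>\<sigma>\<close> would satisfy \<open>F u \<subseteq> hU h\<close> for \<open>u \<in> hU h\<close>,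
  hence \<open>|F| \<le> q\<close>, while \<open>hU h\<close> lies in a two-dimensional space over \<open>F\<close>.
\<close>
lemma affine_central_linear:
  assumes "affine_central f g ax c"
  obtains v A w X where "A \<in> CollGL f" "A \<noteq> mat2_one" "w \<noteq> 0" "act A w = w" "span1 w \<in> Bf f"
    "ax = S.line v (span1 w)" "c = Inr X" "X \<in> Bf f" "X \<in> Dspread" "\<And>y. act A y - y \<in> X"
proof -
  obtain v W X where W: "W \<in> Bf f" and X: "X \<in> Bf f" and ax: "ax = S.line v W" "c = Inr X"
    and axc: "axial_collineation (Bf f) (\<lambda>x. g (v + x) - v) W X"
    and nid: "\<exists>x. g (v + x) - v \<noteq> x"
    using affine_central_normal_form[OF assms] by metis
  define h where "h = (\<lambda>x. g (v + x) - v)"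
  interpret axial_collineation "Bf f" h W X using axc by (simp add: h_def)
  have nidh: "\<exists>x. h x \<noteq> x" using nid by (simp add: h_def)
  obtain \<sigma> where \<sigma>: "\<And>k v. h (sc k v) = sc (\<sigma> k) (h v)"
    using coll_semilinear[OF g additive] by blast
  have not_U: False if t: "t \<noteq> 0" "W = hU t" for t
  proof -
    obtain u1 where u1: "u1 \<in> W" "u1 \<noteq> 0" using S.nontrivial[OF W] by blast
    \<comment> \<open>By scatteredness \<open>W\<close> meets \<open>span1 u1\<close> in
      F_q-multiples of \<open>u1\<close> only, and \<open>W\<close> has more than q elements; so the
      axis contains a second independent vector \<open>u2\<close>.\<close>
    have "\<not> W \<subseteq> (\<lambda>k. sc k u1) ` Fq q"
    proof
      assume "W \<subseteq> (\<lambda>k. sc k u1) ` Fq q"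
      then have "card W \<le> card (Fq q :: 'a set)" by (meson card_image_le card_mono finite le_trans)
      also have "\<dots> = q ^ 1" using card_Fq_q by simp
      also have "\<dots> < q ^ n" using q3 n2 by (intro power_strict_increasing) auto
      finally show False using card_component[OF W] by simp
    qed
    then obtain u2 where u2: "u2 \<in> W" "u2 \<notin> span1 u1"
      using sc_mem_hU_imp_Fq[OF t(1), of u1] u1 t(2) unfolding span1_eq by blast
    let ?F = "{k. \<sigma> k = k}"
    have "?F \<subseteq> Fq q"
    proof clarify
      fix k assume "\<sigma> k = k"
      then have "h (sc k u1) = sc k u1" using \<sigma> axis[OF u1(1)] by simp
      then have "sc k u1 \<in> W" by (rule fixed_point_on_axis) (rule nidh)
      then show "k \<in> Fq q" using sc_mem_hU_imp_Fq t u1 by blast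
    qed
    then have "card ?F \<le> card (Fq q :: 'a set)" by (intro card_mono) auto
    then have F: "card ?F \<le> q" by (simp add: card_Fq_q)
    have "W \<subseteq> (\<lambda>(a, b). sc a u1 + sc b u2) ` (?F \<times> ?F)"
    proof
      fix w assume w: "w \<in> W"
      obtain a b where ab: "w = sc a u1 + sc b u2" using combination_exists u1(2) u2(2) by metis
      have "h w = sc (\<sigma> a) u1 + sc (\<sigma> b) u2"
        unfolding ab additive \<sigma> axis[OF u1(1)] axis[OF u2(1)] ..
      then have "sc (\<sigma> a) u1 + sc (\<sigma> b) u2 = sc a u1 + sc b u2" using axis[OF w] ab by simp
      then have "\<sigma> a = a \<and> \<sigma> b = b" by (simp add: combination_eq_iff[OF u1(2) u2(2)])
      then show "w \<in> (\<lambda>(a, b). sc a u1 + sc b u2) ` (?F \<times> ?F)" using ab by auto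
    qed
    then have "card W \<le> card ((\<lambda>(a, b). sc a u1 + sc b u2) ` (?F \<times> ?F))"
      by (intro card_mono) auto
    also have "\<dots> \<le> card (?F \<times> ?F)" by (intro card_image_le) simp
    also have "\<dots> \<le> q * q" using F by (simp add: card_cartesian_product mult_le_mono)
    also have "\<dots> = q ^ 2" by (simp add: power2_eq_square)
    also have "\<dots> < q ^ n" using q3 n2 by (intro power_strict_increasing) auto
    finally show False using card_component[OF W] by simp
  qed
  obtain w where w: "w \<noteq> 0" "W = span1 w"
    using W not_U by (cases rule: Bf_cases) auto
  have "\<sigma> k = k" for k
  proof -
    have "sc k w \<in> W" "w \<in> W" using w by simp_all
    then have "sc (\<sigma> k) w = sc k w" using axis \<sigma> by metis
    then show ?thesis using w(1) by (simp add: sc_cancel_right)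
  qed
  then have lin: "h (sc k x) = sc k (h x)" for k x using \<sigma> by simp
  obtain A where A: "h = act A" using linear_eq_act[of h] additive lin by blast
  have "A \<in> GL2"
  proof (rule GL2_if_inj)
    fix x assume "act A x = 0"
    then have "h x = h 0" using A by simp
    then show "x = 0" using S.coll_imp_bij[OF g] unfolding bij_def by (blast dest: injD)
  qed
  then have AC: "A \<in> CollGL f" using g A by (simp add: CollGL_iff)
  have AX: "act A x - x \<in> X" for x using center[of x] A by simp
  \<comment> \<open>The displacements of a linear map are closed under scalars, so a nonzero one
    puts a whole F_{q^n}-line into \<open>X\<close>, which scatteredness forbids for
    \<open>hU t\<close>.\<close>
  have "X \<in> Dspread"
    using X
  proof (cases rule: Bf_cases)
    case (U t)
    obtain x where x: "h x \<noteq> x" using nidh by blast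
    have "k \<in> Fq q" for k :: 'a
    proof -
      have "sc k (act A x - x) \<in> X"
        using AX[of "sc k x"] by (simp add: act_sc sc_diff_right)
      then show ?thesis
        using sc_mem_hU_imp_Fq[OF U(1)] AX[of x] U(2) x A by auto
    qed
    then have "CARD('a) \<le> card (Fq q :: 'a set)" by (intro card_mono) auto
    then have "q ^ n \<le> q ^ 1" using card_K card_Fq_q by simp
    moreover have "q ^ 1 < q ^ n" using q3 n2 by (intro power_strict_increasing) auto
    ultimately show ?thesis by simp
  qed simp
  moreover have "A \<noteq> mat2_one" using nidh A by auto
  moreover have "act A w = w" using axis[of w] w A by simp
  ultimately show ?thesis using that AC w W ax X AX by blast
qed

end

section \<open>Linear collineations and the stabilizer\<close>

definition mpow :: "'a::field mat2 \<Rightarrow> nat \<Rightarrow> 'a mat2" where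
  "mpow A k = (mat2_mult A ^^ k) mat2_one"

lemma mpow_0 [simp]: "mpow A 0 = mat2_one"
  and mpow_Suc: "mpow A (Suc k) = mat2_mult A (mpow A k)"
  by (simp_all add: mpow_def)

lemma act_mpow: "act (mpow A k) = act A ^^ k"
proof
  fix v show "act (mpow A k) v = (act A ^^ k) v"
    by (induction k arbitrary: v) (simp_all add: mpow_Suc act_mult funpow_swap1)
qed

lemma mat2_eq_iff: "A = B \<longleftrightarrow> act A = act B"
  using mat2_eqI by metis

lemma one_mem_GL2: "mat2_one \<in> GL2"
  by (simp add: mat2_one_def GL2_def)

lemma scalar_mem_GL2: "k \<noteq> 0 \<Longrightarrow> (k, 0, 0, k) \<in> GL2"
  by (simp add: GL2_def)

lemma scalar_commute: "mat2_mult (k, 0, 0, k) A = mat2_mult A (k, 0, 0, k)"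
  by (simp add: mat2_mult_def mult.commute split: prod.splits)

lemma act_scalar_mult: "act (mat2_mult (k, 0, 0, k) A) v = sc k (act A v)"
  by (simp add: act_mult act_scalar act_sc)

lemma funpow_act_sc: "(act A ^^ i) (sc c v) = sc c ((act A ^^ i) v)"
  using act_sc[of "mpow A i" c v] by (simp add: act_mpow)

lemma funpow_act_add: "(act A ^^ i) (v + w) = (act A ^^ i) v + (act A ^^ i) w"
  using act_add[of "mpow A i" v w] by (simp add: act_mpow)

lemma funpow_act_eigen: "act A v = sc c v \<Longrightarrow> (act A ^^ i) v = sc (c ^ i) v"
  by (induction i) (simp_all add: act_sc mult.commute)

lemma act_image_sc_image: "act A ` sc c ` S = sc c ` act A ` S"
  by (simp add: image_image act_sc)

lemma Gf_mult: "A \<in> Gf f \<Longrightarrow> B \<in> Gf f \<Longrightarrow> mat2_mult A B \<in> Gf f"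
proof -
  assume A: "A \<in> Gf f" "B \<in> Gf f"
  have "act (mat2_mult A B) ` Uf f = act B ` act A ` Uf f"
    by (simp add: act_mult image_image)
  then show ?thesis using A by (simp add: Gf_def GL2_mult)
qed

lemma Gf_one: "mat2_one \<in> Gf f"
  by (simp add: Gf_def one_mem_GL2)

lemma Gf_mpow: "A \<in> Gf f \<Longrightarrow> mpow A i \<in> Gf f"
  by (induction i) (simp_all add: mpow_Suc Gf_one Gf_mult)

lemma card_kernel_homologies:
  "card (kernel_homologies :: 'a::{field,finite} mat2 set) = CARD('a) - 1"
proof -
  have "(kernel_homologies :: 'a mat2 set) = (\<lambda>a. (a, 0, 0, a)) ` (UNIV - {0})"
    by (auto simp: kernel_homologies_def)
  moreover have "card ((\<lambda>a::'a. (a, 0::'a, 0::'a, a)) ` (UNIV - {0})) = card (UNIV - {0::'a})"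
    by (rule card_image) (auto simp: inj_on_def)
  ultimately show ?thesis
    by (simp add: card_Diff_singleton)
qed

text \<open>The preimage \<open>A\<close> of a generator of the multiplicative group generates
  \<open>Gf f\<close>, and its power \<open>CARD('b) - 1\<close> is trivial because the same holds
  in the field. The value \<open>h mat2_one\<close> is a nonzero idempotent, hence 1.\<close>

lemma iso_Gf_generator:
  assumes "Gf_group f \<cong> (mult_group_field :: 'b::{field,finite} monoid)"
  obtains A where "A \<in> Gf f" "\<And>B. B \<in> Gf f \<Longrightarrow> \<exists>i. B = mpow A i"
    "mpow A (CARD('b) - 1) = mat2_one" "card (Gf f) = CARD('b) - 1"
proof -
  obtain h where h: "h \<in> iso (Gf_group f) (mult_group_field :: 'b monoid)"
    using assms by (auto simp: is_iso_def)
  have bij: "bij_betw h (Gf f) (UNIV - {0})"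
    using h by (simp add: iso_def Gf_group_def mult_group_field_def)
  have hom: "h (mat2_mult A B) = h A * h B" if "A \<in> Gf f" "B \<in> Gf f" for A B
    using h that by (simp add: iso_def hom_def Gf_group_def mult_group_field_def)
  have h0: "h A \<noteq> 0" if "A \<in> Gf f" for A
    using bij that by (auto simp: bij_betw_def)
  have inj: "A = B" if "A \<in> Gf f" "B \<in> Gf f" "h A = h B" for A B
    using bij that by (auto simp: bij_betw_def inj_on_def)
  have "h mat2_one * h mat2_one = h mat2_one"
    using hom[OF Gf_one Gf_one] by (simp add: mat2_mult_def mat2_one_def)
  then have h1: "h mat2_one = 1" using h0[OF Gf_one] by simp
  obtain g :: 'b where g: "g \<noteq> 0" "\<And>x. x \<noteq> 0 \<Longrightarrow> \<exists>i. x = g ^ i"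
    using finite_field_mult_cyclic by blast
  obtain A where A: "A \<in> Gf f" "h A = g"
    using bij g(1) unfolding bij_betw_def by (metis DiffI UNIV_I imageE singletonD)
  have pow: "h (mpow A i) = g ^ i" for i
  proof (induction i)
    case (Suc i)
    then show ?case using hom[OF A(1) Gf_mpow[OF A(1)]] A(2) by (simp add: mpow_Suc)
  qed (simp add: h1)
  have "\<exists>i. B = mpow A i" if B: "B \<in> Gf f" for B
  proof -
    obtain i where "h B = g ^ i" using g(2) h0[OF B] by blast
    then show ?thesis using inj[OF B Gf_mpow[OF A(1)]] pow by metis
  qed
  moreover have "g * g ^ (CARD('b) - 1) = g"
    using power_card_UNIV_eq_same[of g] by (metis Suc_pred' power_Suc zero_less_card_finite)
  then have "g ^ (CARD('b) - 1) = 1" using g(1) by simp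
  then have "mpow A (CARD('b) - 1) = mat2_one"
    using inj[OF Gf_mpow[OF A(1)] Gf_one] pow h1 by simp
  moreover have "card (Gf f) = CARD('b) - 1"
    using bij_betw_same_card[OF bij] by (simp add: card_Diff_singleton)
  ultimately show ?thesis using that A(1) by blast
qed

context scattered_map
begin

lemma Fq_proper: "\<exists>k::'a. k \<notin> Fq q"
proof (rule ccontr)
  assume "\<not> ?thesis"
  then have "Fq q = (UNIV :: 'a set)" by auto
  then have "q ^ n = q ^ 1" using card_Fq_q card_K by simp
  moreover have "q ^ 1 < q ^ n" using q3 n2 by (intro power_strict_increasing) auto
  ultimately show False by simp
qed

lemma hU_mem_Bf: "h \<noteq> 0 \<Longrightarrow> hU h \<in> Bf f"
  unfolding Bf_eq by blast

lemma exists_nonzero_Uf: "\<exists>u\<in>Uf f. u \<noteq> 0"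
  using S.nontrivial[OF hU_mem_Bf[of 1]] by (simp add: hU_1)

lemma act_image_hU:
  "act A ` Uf f = hU h \<Longrightarrow> act A ` hU k = hU (k * h)"
  by (metis act_image_sc_image hU_def sc_image_hU)

text \<open>A linear map cannot send U_f onto an F_{q^n}-line, since U_f would then be closed under
  all scalars. Conversely, it commutes with scalars, so one image \<open>hU h\<close> determines the
  images of all subspaces \<open>hU k\<close>; these are permuted, and with them the F_{q^n}-lines
  that meet them only in 0, which are the Desarguesian components.\<close>

lemma CollGL_char: "A \<in> CollGL f \<longleftrightarrow> A \<in> GL2 \<and> (\<exists>h. h \<noteq> 0 \<and> act A ` Uf f = hU h)"
proof
  assume "A \<in> CollGL f"
  then have A: "A \<in> GL2" "S.coll (act A)" by (auto simp: CollGL_iff)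
  have U: "Uf f \<in> Bf f" using hU_mem_Bf[of 1] by (simp add: hU_1)
  have "act A ` Uf f = S.gam (act A) (Uf f)"
    using S.gam_0(2)[OF A(2) U] by simp
  then have B: "act A ` Uf f \<in> Bf f" using S.gam_0(1)[OF A(2) U] by simp
  then have "\<exists>h. h \<noteq> 0 \<and> act A ` Uf f = hU h"
  proof (cases rule: Bf_cases)
    case (D v)
    obtain u where u: "u \<in> Uf f" "u \<noteq> 0" using exists_nonzero_Uf by blast
    have "k \<in> Fq q" for k :: 'a
    proof -
      have "act A u \<in> span1 v" using D(2) u(1) by blast
      then obtain c where "act A u = sc c v" by (auto simp: span1_eq)
      then have "act A (sc k u) \<in> act A ` Uf f" unfolding D(2) by (simp add: act_sc)
      then have "sc k u \<in> Uf f" using act_inj[OF A(1)] by blast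
      then show ?thesis using sc_mem_Uf_imp_Fq u by blast
    qed
    then show ?thesis using Fq_proper by blast
  qed blast
  then show "A \<in> GL2 \<and> (\<exists>h. h \<noteq> 0 \<and> act A ` Uf f = hU h)" using A by blast
next
  assume "A \<in> GL2 \<and> (\<exists>h. h \<noteq> 0 \<and> act A ` Uf f = hU h)"
  then obtain h where A: "A \<in> GL2" and h: "h \<noteq> 0" "act A ` Uf f = hU h" by blast
  have bij: "bij (act A)" by (rule act_bij[OF A])
  have into: "act A ` W \<in> Bf f" if "W \<in> Bf f" for W
    using that
  proof (cases rule: Bf_cases)
    case (D v)
    have Av: "act A v \<noteq> 0" using act_inj[OF A, of v 0] D(1) by auto
    have "span1 (act A v) \<notin> Lf f"
    proof
      assume "span1 (act A v) \<in> Lf f"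
      then obtain s where s: "s \<noteq> 0" "act A v \<in> hU s" using span1_mem_Lf_iff[OF Av] by blast
      then have "act A v \<in> act A ` hU (s / h)" using act_image_hU[OF h(2), of "s / h"] h(1) by simp
      then have "v \<in> hU (s / h)" using act_inj[OF A] by blast
      moreover have "s / h \<noteq> 0" using s(1) h(1) by simp
      ultimately show False using D(3) span1_mem_Lf_iff[OF D(1)] by blast
    qed
    moreover have "span1 (act A v) \<in> Dspread" unfolding Dspread_eq using Av by blast
    ultimately show ?thesis unfolding D(2) act_image_span1 Bf_eq by blast
  next
    case (U k)
    then show ?thesis using act_image_hU[OF h(2), of k] hU_mem_Bf h(1) by simp
  qed
  \<comment> \<open>An injective self-map of the finite set of components is onto; this gives the
    direction from image lines back to lines.\<close>
  have "inj_on ((`) (act A)) (Bf f)"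
    using bij by (auto simp: inj_on_def bij_def inj_image_eq_iff)
  then have onto: "(`) (act A) ` Bf f = Bf f"
    using into by (intro endo_inj_surj) auto
  have img: "act A ` S.line v W = S.line (act A v) (act A ` W)" for v W
    by (simp add: S.line_def image_image act_add)
  have "(\<exists>v W. W \<in> Bf f \<and> L = S.line v W) \<longleftrightarrow> (\<exists>v W. W \<in> Bf f \<and> act A ` L = S.line v W)" for L
  proof
    assume "\<exists>v W. W \<in> Bf f \<and> act A ` L = S.line v W"
    then obtain v W where W: "W \<in> Bf f" "act A ` L = S.line v W" by blast
    obtain W' where W': "W' \<in> Bf f" "W = act A ` W'" using onto W(1) by blast
    obtain v' where "v = act A v'" using bij by (metis bij_pointE)
    then have "act A ` L = act A ` S.line v' W'" using W W' img by simp
    then have "L = S.line v' W'" using bij by (simp add: bij_def inj_image_eq_iff)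
    then show "\<exists>v W. W \<in> Bf f \<and> L = S.line v W" using W' by blast
  qed (use img into in blast)
  then have "S.coll (act A)" unfolding S.coll_def using bij by blast
  then show "A \<in> CollGL f" using A by (simp add: CollGL_iff)
qed

lemma CollGL_mult: "A \<in> CollGL f \<Longrightarrow> B \<in> CollGL f \<Longrightarrow> mat2_mult A B \<in> CollGL f"
proof -
  assume A: "A \<in> CollGL f" "B \<in> CollGL f"
  obtain h where h: "h \<noteq> 0" "act A ` Uf f = hU h" using A CollGL_char by blast
  obtain k where k: "k \<noteq> 0" "act B ` Uf f = hU k" using A CollGL_char by blast
  have "act (mat2_mult A B) ` Uf f = act B ` act A ` Uf f" by (simp add: act_mult image_image)
  also have "\<dots> = hU (h * k)" using act_image_hU[OF k(2)] h(2) by simp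
  finally have "act (mat2_mult A B) ` Uf f = hU (h * k)" .
  moreover have "h * k \<noteq> 0" using h k by simp
  ultimately show ?thesis using A GL2_mult CollGL_char by blast
qed

lemma scalar_mem_CollGL: "k \<noteq> 0 \<Longrightarrow> (k, 0, 0, k) \<in> CollGL f"
  unfolding CollGL_char hU_def by (auto simp: scalar_mem_GL2 act_scalar)

lemma one_mem_CollGL: "mat2_one \<in> CollGL f"
  using scalar_mem_CollGL[of 1] by (simp add: mat2_one_def)

lemma Gf_subset_CollGL: "A \<in> Gf f \<Longrightarrow> A \<in> CollGL f"
  unfolding CollGL_char Gf_def using hU_1 by (auto intro!: exI[of _ 1])

lemma mpow_mem_CollGL: "A \<in> CollGL f \<Longrightarrow> mpow A i \<in> CollGL f"
  by (induction i) (simp_all add: mpow_Suc one_mem_CollGL CollGL_mult)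

lemma CollGL_decompose:
  assumes "A \<in> CollGL f"
  obtains k B where "k \<noteq> 0" "B \<in> Gf f" "A = mat2_mult (k, 0, 0, k) B"
proof -
  obtain h where h: "h \<noteq> 0" "act A ` Uf f = hU h" and A: "A \<in> GL2"
    using assms CollGL_char by blast
  define B where "B = mat2_mult (1 / h, 0, 0, 1 / h) A"
  have "act B ` Uf f = sc (1 / h) ` act A ` Uf f"
    by (auto simp: B_def act_scalar_mult image_image)
  also have "\<dots> = Uf f" using h hU_1 by (simp add: sc_image_hU)
  finally have "act B ` Uf f = Uf f" .
  moreover have "B \<in> GL2" unfolding B_def using A h by (intro GL2_mult scalar_mem_GL2) auto
  ultimately have "B \<in> Gf f" by (simp add: Gf_def)
  moreover have "A = mat2_mult (h, 0, 0, h) B"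
    using h by (intro mat2_eqI) (simp add: B_def act_scalar_mult)
  ultimately show ?thesis using that h by blast
qed

lemma scalar_mult_mem_Gf_iff:
  assumes "B \<in> Gf f" "k \<noteq> 0"
  shows "mat2_mult (k, 0, 0, k) B \<in> Gf f \<longleftrightarrow> k \<in> Fq q"
proof -
  have B: "B \<in> GL2" "act B ` Uf f = Uf f" using assms by (auto simp: Gf_def)
  have "act (mat2_mult (k, 0, 0, k) B) ` Uf f = sc k ` Uf f"
    using B(2) by (metis (no_types, lifting) act_scalar_mult image_cong image_image)
  moreover have "mat2_mult (k, 0, 0, k) B \<in> GL2"
    using B assms by (intro GL2_mult scalar_mem_GL2)
  ultimately have "mat2_mult (k, 0, 0, k) B \<in> Gf f \<longleftrightarrow> sc k ` Uf f = Uf f"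
    by (simp add: Gf_def)
  also have "\<dots> \<longleftrightarrow> k \<in> Fq q"
  proof
    assume eq: "sc k ` Uf f = Uf f"
    obtain u where u: "u \<in> Uf f" "u \<noteq> 0" using exists_nonzero_Uf by blast
    then have "sc k u \<in> Uf f" using eq by blast
    then show "k \<in> Fq q" using sc_mem_Uf_imp_Fq u by blast
  qed (rule sc_image_Uf[OF _ assms(2)])
  finally show ?thesis .
qed

lemma scalar_mem_Gf_iff: "k \<noteq> 0 \<Longrightarrow> (k, 0, 0, k) \<in> Gf f \<longleftrightarrow> k \<in> Fq q"
  using scalar_mult_mem_Gf_iff[OF Gf_one, of k]
  by (simp add: mat2_mult_def mat2_one_def)

lemma card_scalars_Gf: "card ((\<lambda>k. (k, 0, 0, k)) ` (Fq q - {0}) :: 'a mat2 set) = q - 1"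
  using card_Fq_q by (subst card_image) (auto simp: inj_on_def card_Diff_singleton)

text \<open>The scalars from F_q already supply q - 1 elements of \<open>Gf f\<close>, so all linear
  collineations are scalar. A scalar matrix fixing a nonzero vector is the identity, whereas an
  affine central collineation would yield a nonidentity linear collineation with such a
  vector.\<close>

lemma trivial_stabilizer:
  assumes "card (Gf f) = q - 1"
  shows "\<not> (\<exists>g ax c. affine_central f g ax c)" "CollGL f = kernel_homologies"
    "card (CollGL f) = q ^ n - 1"
proof -
  have sub: "(\<lambda>k. (k, 0, 0, k)) ` (Fq q - {0}) \<subseteq> Gf f"
    using scalar_mem_Gf_iff by auto
  have G: "Gf f = (\<lambda>k. (k, 0, 0, k)) ` (Fq q - {0})"
    using card_subset_eq[OF _ sub] card_scalars_Gf assms by simp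
  show C: "CollGL f = kernel_homologies"
  proof (intro equalityI subsetI)
    fix A assume "A \<in> CollGL f"
    then obtain k B where k: "k \<noteq> 0" "B \<in> Gf f" "A = mat2_mult (k, 0, 0, k) B"
      by (rule CollGL_decompose)
    then obtain l where "B = (l, 0, 0, l)" "l \<noteq> 0" using G by auto
    then have "A = (k * l, 0, 0, k * l)" "k * l \<noteq> 0" using k by (auto simp: mat2_mult_def)
    then show "A \<in> kernel_homologies" unfolding kernel_homologies_def by blast
  next
    fix A :: "'a mat2" assume "A \<in> kernel_homologies"
    then show "A \<in> CollGL f" using scalar_mem_CollGL by (auto simp: kernel_homologies_def)
  qed
  then show "card (CollGL f) = q ^ n - 1" by (simp add: card_kernel_homologies card_K)
  show "\<not> (\<exists>g ax c. affine_central f g ax c)"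
  proof clarify
    fix g ax c assume "affine_central f g ax c"
    then obtain A w where A: "A \<in> CollGL f" "A \<noteq> mat2_one" "w \<noteq> 0" "act A w = w"
      by (rule affine_central_linear)
    then obtain k where k: "A = (k, 0, 0, k)" using C by (auto simp: kernel_homologies_def)
    then have "sc k w = sc 1 w" using A by (simp add: act_scalar)
    then have "k = 1" using A(3) sc_cancel_right by blast
    then show False using A(2) k by (simp add: mat2_one_def)
  qed
qed

end

section \<open>Eigenvectors of elements of the stabilizer\<close>

lemma sc_sum_right: "sc c (sum h I) = (\<Sum>i\<in>I. sc c (h i))"
  by (induction I rule: infinite_finite_induct) (simp_all add: sc_add_right)

lemma sc_sum_left: "sc (sum h I) v = (\<Sum>i\<in>I. sc (h i) v)"
  by (induction I rule: infinite_finite_induct) (simp_all add: sc_add_left)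

lemma act_sum: "act A (sum h I) = (\<Sum>i\<in>I. act A (h i))"
  by (induction I rule: infinite_finite_induct) (simp_all add: act_add)

text \<open>A discrete Fourier transform over the multiplicative group: \<open>- E k\<close> is the
  component of \<open>s\<close> in the eigenspace of 1/k. \<open>shift\<close> holds because
  \<open>k\<close> and \<open>s\<close> both return after \<open>CARD('a) - 1\<close> steps, which
  closes the sum cyclically. Summing over all \<open>k\<close> gives \<open>- s\<close>, so some
  \<open>E k\<close> is nonzero.\<close>

lemma eigenvector_if_power_fixes:
  fixes A :: "'a::{field,finite} mat2"
  assumes pow_s: "(act A ^^ (CARD('a) - 1)) s = s" and s: "s \<noteq> 0" and N: "CARD('a) > 2"
  obtains e c where "e \<noteq> 0" "act A e = sc c e"
proof -
  let ?N = "CARD('a) - 1"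
  define E where "E = (\<lambda>k. \<Sum>j<?N. sc (k ^ j) ((act A ^^ j) s))"
  have shift: "sc k (act A (E k)) = E k" if k: "k \<noteq> 0" for k
  proof -
    let ?a = "\<lambda>j. sc (k ^ j) ((act A ^^ j) s)"
    have "k * k ^ ?N = k"
      using power_card_UNIV_eq_same[of k] by (metis Suc_pred' power_Suc zero_less_card_finite)
    then have "k ^ ?N = 1" using k by simp
    then have aN: "?a ?N = ?a 0" using pow_s by simp
    have "sc k (act A (E k)) = (\<Sum>j<?N. ?a (Suc j))"
      by (simp add: E_def act_sum act_sc sc_sum_right)
    then have "?a 0 + sc k (act A (E k)) = (\<Sum>j<Suc ?N. ?a j)"
      by (simp only: sum.lessThan_Suc_shift)
    also have "\<dots> = E k + ?a 0" unfolding sum.lessThan_Suc aN E_def ..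
    finally show ?thesis by simp
  qed
  have "(\<Sum>k\<in>UNIV - {0}. E k) = (\<Sum>j<?N. \<Sum>k\<in>UNIV - {0}. sc (k ^ j) ((act A ^^ j) s))"
    unfolding E_def by (rule sum.swap)
  also have "\<dots> = (\<Sum>j<?N. sc (\<Sum>k\<in>UNIV - {0}. k ^ j) ((act A ^^ j) s))"
    by (simp add: sc_sum_left)
  also have "\<dots> = (\<Sum>j\<in>{0}. sc (\<Sum>k\<in>UNIV - {0}. k ^ j) ((act A ^^ j) s))"
    using N sum_power_nonzero_eq_0 by (intro sum.mono_neutral_right) auto
  also have "\<dots> = sc (of_nat ?N) s"
    by (simp add: card_Diff_singleton)
  \<comment> \<open>The number of nonzero scalars is -1 in the field, hence invertible
    there.\<close>
  also have "of_nat ?N = (- 1 :: 'a)"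
  proof -
    have "of_nat (CARD('a)) = (0 :: 'a)"
      using CHAR_dvd_CARD[where 'a='a] by (simp add: of_nat_eq_0_iff_char_dvd)
    moreover have "of_nat (CARD('a)) = (1 + of_nat ?N :: 'a)"
      using N by (metis Suc_pred' of_nat_Suc zero_less_card_finite)
    ultimately show ?thesis by (metis add_eq_0_iff)
  qed
  finally have "(\<Sum>k\<in>UNIV - {0}. E k) \<noteq> 0" using s by simp
  then obtain k where k: "k \<noteq> 0" "E k \<noteq> 0"
    by (metis (no_types, lifting) DiffD2 singletonI sum.neutral)
  have "act A (E k) = sc (1 / k) (sc k (act A (E k)))" using k by simp
  then have "act A (E k) = sc (1 / k) (E k)" unfolding shift[OF k(1)] .
  then show ?thesis using that k by blast
qed

context scattered_map
begin

text \<open>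
  Without eigenvectors, a power of \<open>A\<close> fixing one nonzero vector \<open>s\<close> fixes the basis
  \<open>s, A s\<close>, so \<open>A\<close> acts on \<open>Uf f - {0}\<close> with orbits of equal length.
\<close>
lemma Gf_eigenvector:
  assumes A: "A \<in> Gf f"
  obtains e c where "e \<noteq> 0" "act A e = sc c e"
proof (cases "\<exists>e c. e \<noteq> 0 \<and> act A e = sc c e")
  case False
  have GL: "A \<in> GL2" and img: "act A ` Uf f = Uf f" using A by (auto simp: Gf_def)
  let ?S = "Uf f - {0}"
  obtain s where s: "s \<in> Uf f" "s \<noteq> 0" using exists_nonzero_Uf by blast
  have semireg: "(act A ^^ i) x = x" if u: "u \<noteq> 0" "(act A ^^ i) u = u" for i u x
  proof -
    have Au: "act A u \<notin> span1 u" using False u(1) unfolding span1_eq by blast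
    have "(act A ^^ i) (act A u) = act A u" using u(2) by (simp add: funpow_swap1[symmetric])
    moreover obtain a b where "x = sc a u + sc b (act A u)"
      using combination_exists[OF u(1) Au] by metis
    ultimately show ?thesis using u(2) by (simp add: funpow_act_add funpow_act_sc)
  qed
  have "inj (act A)" using act_inj[OF GL] by (blast intro: injI)
  then have "act A ` ?S = Uf f - {0}"
    using img by (simp add: image_set_diff)
  then have bij: "bij_betw (act A) ?S ?S"
    using \<open>inj (act A)\<close> by (auto simp: bij_betw_def intro: inj_on_subset)
  \<comment> \<open>U_f has as many nonzero vectors as there are nonzero scalars; so the orbit
    argument produces exactly the exponent required by the Fourier sum.\<close>
  have "card ?S = CARD('a) - 1"
    using card_hU[of 1] by (simp add: hU_1 card_K card_Diff_singleton)
  moreover have "\<forall>x\<in>?S. (act A ^^ card ?S) x = x"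
    by (rule funpow_card_eq_id) (use s semireg bij in auto)
  ultimately have "(act A ^^ (CARD('a) - 1)) s = s" using s by simp
  moreover have "CARD('a) > 2" using qn_ge by (simp add: card_K)
  ultimately obtain e c where "e \<noteq> 0" "act A e = sc c e"
    using eigenvector_if_power_fixes s(2) by blast
  then show ?thesis using that by blast
qed (use that in blast)

text \<open>
  For a double eigenvalue, \<open>A\<close> would have an order divisible by the characteristic.
\<close>
lemma second_eigenvector:
  fixes A :: "'a mat2"
  assumes A: "A \<in> GL2" and nonscalar: "\<And>k. A \<noteq> (k, 0, 0, k)"
    and order: "(act A ^^ q ^ t) = act A" and t: "t > 0"
    and e1: "e1 \<noteq> 0" "act A e1 = sc \<alpha> e1"
  obtains e2 \<beta> where "e2 \<notin> span1 e1" "act A e2 = sc \<beta> e2" "\<alpha> \<noteq> \<beta>"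
proof -
  have \<alpha>0: "\<alpha> \<noteq> 0" using act_inj[OF A, of e1 0] e1 by auto
  have "card (span1 e1) < CARD('a \<times> 'a)"
    using card_span1[OF e1(1)] card_K card_plane qn_ge q3 by simp
  then have "span1 e1 \<noteq> UNIV" by auto
  then obtain e where e: "e \<notin> span1 e1" by blast
  obtain \<gamma> \<beta> where \<gamma>: "act A e = sc \<gamma> e1 + sc \<beta> e"
    using combination_exists[OF e1(1) e] by metis
  have "\<beta> \<noteq> \<alpha>"
  proof
    assume \<beta>: "\<beta> = \<alpha>"
    \<comment> \<open>With a double eigenvalue \<open>A\<close> acts as a Jordan block, and its i-th
      power maps \<open>e\<close> to \<alpha>^i (e + i \<delta> e1). For i = q^t the shear vanishes
      in the field, while \<open>order\<close> requires it to equal that of \<open>A\<close>; so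
      \<delta> = 0.\<close>
    define \<delta> where "\<delta> = \<gamma> / \<alpha>"
    have Ae: "act A e = sc \<alpha> (e + sc \<delta> e1)"
      using \<gamma> \<beta> \<alpha>0 by (simp add: \<delta>_def sc_add_right add.commute)
    have pow: "(act A ^^ i) e = sc (\<alpha> ^ i) (e + sc (of_nat i * \<delta>) e1)" for i
    proof (induction i)
      case (Suc i)
      have "(act A ^^ Suc i) e = act A (sc (\<alpha> ^ i) (e + sc (of_nat i * \<delta>) e1))"
        by (simp add: Suc)
      also have "\<dots> = sc (\<alpha> ^ i) (sc \<alpha> (e + sc \<delta> e1) + sc (of_nat i * \<delta>) (sc \<alpha> e1))"
        by (simp only: act_sc act_add Ae e1(2))
      also have "\<dots> = sc (\<alpha> ^ Suc i) (e + sc (of_nat (Suc i) * \<delta>) e1)"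
        by (simp add: sc_add_right sc_add_left algebra_simps)
      finally show ?case .
    qed simp
    have "of_nat (q ^ t) = (0 :: 'a)"
    proof -
      have "of_nat (CARD('a)) = (0 :: 'a)"
        using CHAR_dvd_CARD[where 'a='a] by (simp add: of_nat_eq_0_iff_char_dvd)
      then have "of_nat q ^ n = (0 :: 'a)" by (simp add: card_K)
      then show ?thesis using t by (simp add: power_eq_0_iff)
    qed
    then have "(act A ^^ q ^ t) e = sc (\<alpha> ^ q ^ t) e" unfolding pow by (simp del: of_nat_power)
    then have "sc (\<alpha> * \<delta>) e1 + sc \<alpha> e = sc 0 e1 + sc (\<alpha> ^ q ^ t) e"
      using order Ae by (simp add: sc_add_right add.commute)
    then have "\<alpha> * \<delta> = 0" unfolding combination_eq_iff[OF e1(1) e] by (rule conjunct1)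
    then have "\<delta> = 0" using \<alpha>0 by simp
    then have Ae: "act A e = sc \<alpha> e" using Ae by simp
    have "A = (\<alpha>, 0, 0, \<alpha>)"
    proof (rule mat2_eqI)
      fix v
      obtain x y where "v = sc x e1 + sc y e" using combination_exists[OF e1(1) e] by metis
      then show "act A v = act (\<alpha>, 0, 0, \<alpha>) v"
        by (simp add: act_add act_sc Ae e1(2) act_scalar sc_add_right mult.commute)
    qed
    then show False using nonscalar by blast
  qed
  \<comment> \<open>The solution of \<gamma> + c \<alpha> = \<beta> c, the condition for
    \<open>e + sc c e1\<close> to be an eigenvector for \<beta>.\<close>
  define c where "c = \<gamma> / (\<beta> - \<alpha>)"
  have c: "\<gamma> + c * \<alpha> = \<beta> * c" using \<open>\<beta> \<noteq> \<alpha>\<close> by (simp add: c_def field_simps)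
  have "act A (e + sc c e1) = sc (\<gamma> + c * \<alpha>) e1 + sc \<beta> e"
    by (simp add: act_add act_sc \<gamma> e1(2) sc_add_left algebra_simps)
  also have "\<dots> = sc \<beta> (e + sc c e1)" unfolding c by (simp add: sc_add_right add.commute)
  finally have "act A (e + sc c e1) = sc \<beta> (e + sc c e1)" .
  moreover have "e + sc c e1 \<notin> span1 e1"
  proof
    assume "e + sc c e1 \<in> span1 e1"
    then obtain d where "e + sc c e1 = sc d e1" by (auto simp: span1_eq)
    then have "e = sc (d - c) e1" by (simp add: sc_diff_left algebra_simps)
    then show False using e by simp
  qed
  ultimately show ?thesis using that \<open>\<beta> \<noteq> \<alpha>\<close> by metis
qed

text \<open>
  If the first eigenline meets \<open>Uf f\<close>, the second coordinates of \<open>Uf f\<close> form a set of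
  \<open>q ^ (n - 1)\<close> elements invariant under \<open>\<beta>\<close>.  Hence \<open>\<beta>\<close> satisfies both
  \<open>\<beta> ^ (q ^ (n - 1)) = \<beta>\<close> and \<open>\<beta> ^ (q ^ n) = \<beta>\<close>, so it lies in \<open>Fq q\<close>, and then \<open>Uf f\<close> meets the
  second eigenline in too many points.
\<close>
lemma eigenline_notin_Lf:
  assumes A: "A \<in> Gf f" and e1: "e1 \<noteq> 0" "act A e1 = sc \<alpha> e1"
    and e2: "e2 \<notin> span1 e1" "act A e2 = sc \<beta> e2" and ne: "\<alpha> \<noteq> \<beta>"
  shows "span1 e1 \<notin> Lf f"
proof
  assume "span1 e1 \<in> Lf f"
  then obtain h where h: "h \<noteq> 0" "e1 \<in> hU h" using span1_mem_Lf_iff[OF e1(1)] by blast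
  define e where "e = sc (1 / h) e1"
  have e: "e \<in> Uf f" "e \<noteq> 0" using h e1 by (auto simp: e_def hU_iff)
  have Ae: "act A e = sc \<alpha> e" by (simp add: e_def act_sc e1(2) mult.commute)
  have e2e: "e2 \<notin> span1 e" using e2(1) span1_eqI[of e e1] e(2) by (simp add: e_def)
  have GL: "A \<in> GL2" and img: "act A ` Uf f = Uf f" using A by (auto simp: Gf_def)
  have "act A e \<in> Uf f" using img e(1) by blast
  then have "sc \<alpha> e \<in> Uf f" by (simp add: Ae)
  then have \<alpha>: "\<alpha> \<in> Fq q" using sc_mem_Uf_imp_Fq e by blast
  have e20: "e2 \<noteq> 0" using e2(1) zero_mem_span1 by metis
  have \<beta>0: "\<beta> \<noteq> 0" using act_inj[OF GL, of e2 0] e2(2) e20 by auto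
  have "\<exists>p. v = sc (fst p) e + sc (snd p) e2" for v
  proof -
    obtain x y where "v = sc x e + sc y e2" by (rule combination_exists[OF e(2) e2e])
    then show ?thesis by (intro exI[of _ "(x, y)"]) simp
  qed
  then obtain P where P: "\<forall>v. v = sc (fst (P v)) e + sc (snd (P v)) e2"
    using choice[of "\<lambda>v p. v = sc (fst p) e + sc (snd p) e2"] by blast
  define X Y where "X = (\<lambda>v. fst (P v))" and "Y = (\<lambda>v. snd (P v))"
  have XY: "v = sc (X v) e + sc (Y v) e2" for v
    unfolding X_def Y_def by (rule spec[OF P])
  have Y_eq: "Y (sc x e + sc y e2) = y" for x y
    using XY[of "sc x e + sc y e2"] unfolding combination_eq_iff[OF e(2) e2e]
    by (rule conjunct2[THEN sym])
  \<comment> \<open>The image of U_f under the projection along \<open>e\<close>; it is stable under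
    \<beta> because \<open>Y\<close> turns \<open>act A\<close> into multiplication by
    \<beta>.\<close>
  define S where "S = Y ` Uf f"
  have Y_act: "Y (act A v) = \<beta> * Y v" for v
  proof -
    have "act A v = act A (sc (X v) e + sc (Y v) e2)" by (rule arg_cong[where f = "act A", OF XY])
    also have "\<dots> = sc (X v * \<alpha>) e + sc (\<beta> * Y v) e2"
      by (simp add: act_add act_sc Ae e2(2) mult.commute)
    finally show ?thesis by (simp add: Y_eq)
  qed
  have "(*) \<beta> ` S = Y ` act A ` Uf f" by (simp add: S_def image_image Y_act)
  then have \<beta>S: "(*) \<beta> ` S = S" by (simp add: img S_def)
  have "card (Uf f) = q * card S"
    unfolding S_def
  proof (rule card_eq_card_image_mult)
    fix u assume u: "u \<in> Uf f"
    \<comment> \<open>A fibre of the projection is a coset of the intersection of U_f with the line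
      of \<open>e\<close>, which by scatteredness consists of the F_q-multiples of
      \<open>e\<close>.\<close>
    have "{v \<in> Uf f. Y v = Y u} = (\<lambda>c. u + sc c e) ` Fq q"
    proof (intro equalityI subsetI)
      fix v assume v: "v \<in> {v \<in> Uf f. Y v = Y u}"
      have *: "v - u = sc (X v - X u) e"
      proof -
        have "v - u = (sc (X v) e + sc (Y v) e2) - (sc (X u) e + sc (Y u) e2)"
          by (rule arg_cong2[where f = minus, OF XY XY])
        also have "\<dots> = sc (X v - X u) e" using v by (simp add: sc_diff_left)
        finally show ?thesis .
      qed
      have "v - u \<in> Uf f" using v u diff_mem_Uf by blast
      then have "X v - X u \<in> Fq q" using sc_mem_Uf_imp_Fq e * by metis
      moreover have "v = u + sc (X v - X u) e" using * by (simp add: algebra_simps)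
      ultimately show "v \<in> (\<lambda>c. u + sc c e) ` Fq q" by blast
    next
      fix v assume "v \<in> (\<lambda>c. u + sc c e) ` Fq q"
      then obtain c where c: "c \<in> Fq q" "v = u + sc c e" by blast
      have "v = (sc (X u) e + sc (Y u) e2) + sc c e"
        unfolding c(2) by (rule arg_cong[where f = "\<lambda>w. w + sc c e", OF XY])
      also have "\<dots> = sc (X u + c) e + sc (Y u) e2" by (simp add: sc_add_left)
      finally have "v = sc (X u + c) e + sc (Y u) e2" .
      then have "Y v = Y u" by (simp add: Y_eq)
      then show "v \<in> {v \<in> Uf f. Y v = Y u}" using c u e add_mem_Uf sc_mem_Uf by simp
    qed
    moreover have "inj_on (\<lambda>c. u + sc c e) (Fq q)"
      using e(2) by (auto simp: inj_on_def sc_cancel_right)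
    ultimately show "card {v \<in> Uf f. Y v = Y u} = q" by (simp add: card_image card_Fq_q)
  qed simp
  moreover have "card (Uf f) = q ^ n" using card_hU[of 1] by (simp add: hU_1)
  moreover have "q ^ n = q * q ^ (n - 1)" using n2 by (simp flip: power_Suc)
  ultimately have cS: "card S = q ^ (n - 1)" using q3 by simp
  have "Y 0 = 0" using Y_eq[of 0 0] by simp
  then have "0 \<in> S" unfolding S_def using zero_mem_Uf by (metis imageI)
  then have "\<beta> ^ q ^ (n - 1) = \<beta>"
    using power_card_eq_if_mult_image_eq[of S \<beta>] \<beta>S cS by simp
  then have "\<beta> ^ q = \<beta> ^ (q ^ (n - 1) * q)" by (simp add: power_mult)
  also have "q ^ (n - 1) * q = CARD('a)" using n2 by (simp add: card_K flip: power_Suc2)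
  also have "\<beta> ^ CARD('a) = \<beta>" by (rule power_card_UNIV_eq_same)
  finally have \<beta>: "\<beta> \<in> Fq q" by (simp add: Fq_def)
  \<comment> \<open>Subtracting \<alpha> times the identity from \<open>A\<close> removes the
    \<open>e\<close>-coordinate, and the result stays in U_f because \<alpha> lies in F_q. The
    q^(n-1) elements of \<open>S\<close> thus give distinct vectors of U_f on the line of
    \<open>e2\<close>, which has room for q only.\<close>
  have meet: "sc ((\<beta> - \<alpha>) * y) e2 \<in> Uf f" if y: "y \<in> S" for y
  proof -
    obtain u where u: "u \<in> Uf f" "y = Y u" using y unfolding S_def by blast
    have "act A u - sc \<alpha> u \<in> Uf f"
      using u img \<alpha> by (intro diff_mem_Uf sc_mem_Uf) auto
    moreover have "act A u - sc \<alpha> u = sc ((\<beta> - \<alpha>) * y) e2"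
    proof -
      have "act A u - sc \<alpha> u = act A (sc (X u) e + sc y e2) - sc \<alpha> (sc (X u) e + sc y e2)"
        unfolding u(2) by (rule arg_cong[where f = "\<lambda>w. act A w - sc \<alpha> w", OF XY])
      also have "\<dots> = sc ((\<beta> - \<alpha>) * y) e2"
        by (simp add: act_add act_sc Ae e2(2) sc_add_right sc_diff_left algebra_simps)
      finally show ?thesis .
    qed
    ultimately show ?thesis by simp
  qed
  have lt: "q ^ 1 < q ^ (n - 1)" using q3 n2 by (intro power_strict_increasing) auto
  have "\<not> S \<subseteq> {0}"
  proof
    assume "S \<subseteq> {0}"
    then have "card S \<le> 1" using card_mono[of "{0}" S] by simp
    then show False using cS lt q3 by simp
  qed
  then obtain y0 where y0: "y0 \<in> S" "y0 \<noteq> 0" by blast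
  have "S \<subseteq> (\<lambda>c. c * y0) ` Fq q"
  proof
    fix y assume y: "y \<in> S"
    have "sc (y / y0) (sc ((\<beta> - \<alpha>) * y0) e2) = sc ((\<beta> - \<alpha>) * y) e2" using y0 by (simp add: mult.commute)
    then have "y / y0 \<in> Fq q"
      using sc_mem_Uf_imp_Fq[OF meet[OF y0(1)], of "y / y0"] meet[OF y] y0 ne e20 by simp
    moreover have "y = y / y0 * y0" using y0 by simp
    ultimately show "y \<in> (\<lambda>c. c * y0) ` Fq q" by blast
  qed
  then have "card S \<le> card ((\<lambda>c. c * y0) ` Fq q)" by (intro card_mono) auto
  also have "\<dots> \<le> q" using card_image_le[of "Fq q"] card_Fq_q by (metis finite)
  finally show False using cS lt by simp
qed

text \<open>Converse of the reduction to linear maps. The lines through the centre are the cosets of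
  \<open>X\<close>, which the condition on displacements makes invariant, and the line at infinity,
  whose points are permuted by \<open>gam\<close>.\<close>

lemma act_affine_homology:
  assumes A: "A \<in> CollGL f" "A \<noteq> mat2_one" and W: "W \<in> Bf f" and X: "X \<in> Bf f" and XW: "X \<noteq> W"
    and axis: "\<And>w. w \<in> W \<Longrightarrow> act A w = w" and center: "\<And>v. act A v - v \<in> X"
  shows "affine_homology f (act A) W (Inr X)"
proof -
  have g: "S.coll (act A)" using A by (simp add: CollGL_iff)
  interpret axial_collineation "Bf f" "act A" W X
    by standard (rule g W X axis center; assumption?)+
  have W_line: "W = S.line 0 W" by simp
  have "inj_on (S.gam (act A)) (Bf f)"
    by (rule inj_onI, rule S.gam_inj[OF g])
  then have into: "S.gam (act A) ` Bf f = Bf f"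
    using S.gam_0(1)[OF g] by (intro endo_inj_surj image_subsetI) simp_all
  have "central_collineation (proj_points f) (proj_lines f) proj_inc (ext f (act A)) (Some W) (Inr X)"
    unfolding central_collineation_def
  proof (intro conjI ballI impI)
    show "Some W \<in> proj_lines f"
      unfolding proj_lines_def lines_def translate_line using W W_line by blast
    show "Inr X \<in> proj_points f" using X by (simp add: proj_points_def)
    obtain v where "act A v \<noteq> act mat2_one v" using A(2) mat2_eqI by metis
    then have "ext f (act A) (Inl v) \<noteq> Inl v" by (simp add: ext_def)
    moreover have "Inl v \<in> proj_points f" by (simp add: proj_points_def)
    ultimately show "\<exists>p\<in>proj_points f. ext f (act A) p \<noteq> p" by blast
  next
    fix p assume p: "p \<in> proj_points f" "proj_inc p (Some W)"
    show "ext f (act A) p = p"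
    proof (cases p)
      case (Inl x)
      then show ?thesis using p axis by (simp add: proj_inc_def ext_def)
    next
      case (Inr Z)
      then have "Z \<in> Bf f" using p(1) by (auto simp: proj_points_def)
      then have "Z = W" using p(2) Inr proj_inc_Inr[of Z W 0] W by simp
      then show ?thesis using Inr ext_Inr[OF g W] gam_axis by simp
    qed
  next
    fix l assume l: "l \<in> proj_lines f" "proj_inc (Inr X) l"
    show "ext f (act A) ` {p \<in> proj_points f. proj_inc p l} = {p \<in> proj_points f. proj_inc p l}"
    proof (cases l)
      case None
      have "{p \<in> proj_points f. proj_inc p l} = Inr ` Bf f"
        by (auto simp: None proj_points_def proj_inc_def)
      moreover have "ext f (act A) ` Inr ` Bf f = Inr ` S.gam (act A) ` Bf f"
        unfolding image_image by (intro image_cong) (auto simp: ext_Inr[OF g])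
      ultimately show ?thesis by (simp add: into)
    next
      case (Some L)
      then have "L \<in> lines f" using l by (auto simp: proj_lines_def)
      then obtain u Z where Z: "Z \<in> Bf f" "L = S.line u Z" by (auto simp: lines_def translate_line)
      then have "Z = X" using l(2) Some proj_inc_Inr[OF X] by simp
      then have L: "L = S.line u X" using Z by simp
      have "{p \<in> proj_points f. proj_inc p l} = Inl ` L \<union> {Inr X}"
      proof (rule Set.set_eqI)
        fix p
        show "p \<in> {p \<in> proj_points f. proj_inc p l} \<longleftrightarrow> p \<in> Inl ` L \<union> {Inr X}"
        proof (cases p)
          case (Inl x)
          then show ?thesis by (auto simp: Some proj_points_def proj_inc_def)
        next
          case (Inr V)
          then show ?thesis
            using proj_inc_Inr[OF _ X, of V u] X by (auto simp: Some L proj_points_def)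
        qed
      qed
      moreover have "act A ` L = L"
        using S.coll_image_line[OF g X, of u] gam_center S.line_eqI[OF X, of "act A u" u] center
        by (simp add: L S.mem_line_iff)
      moreover have "ext f (act A) ` (Inl ` L \<union> {Inr X}) = Inl ` act A ` L \<union> {Inr X}"
        using gam_center ext_Inr[OF g X] by (simp add: image_Un image_image ext_def)
      ultimately show ?thesis by simp
    qed
  qed
  moreover have "W \<in> lines f" unfolding lines_def translate_line using W W_line by blast
  moreover have "\<not> proj_inc (Inr X) (Some W)" using proj_inc_Inr[OF X W, of 0] XW by simp
  ultimately show ?thesis
    using g by (simp add: affine_homology_def affine_central_def collineation_iff)
qed


section \<open>Homology groups of a cyclic stabilizer\<close>

lemma eigenvalue_nonzero: "A \<in> GL2 \<Longrightarrow> e \<noteq> 0 \<Longrightarrow> act A e = sc c e \<Longrightarrow> c \<noteq> 0"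
  using act_inj[of A e 0] by auto

text \<open>Dividing \<open>A\<close> by its eigenvalue on \<open>e\<close> gives the generator
  \<open>D\<close>. The same normalisation \<open>\<Phi>\<close> of all elements maps
  \<open>Gf f\<close> onto \<open>C\<close>; two elements have equal images exactly if they differ
  by a nonzero scalar of F_q, so every fibre has q - 1 elements.\<close>

lemma homology_group_cyclic:
  assumes A: "A \<in> Gf f" and gen: "\<And>B. B \<in> Gf f \<Longrightarrow> \<exists>i. B = mpow A i"
    and e: "e \<noteq> 0" "act A e = sc \<alpha> e"
  defines "C \<equiv> {B \<in> CollGL f. act B e = e}"
  obtains D where "D \<in> GL2" "C = range (mpow D)" "card (Gf f) = (q - 1) * card C"
proof -
  have \<alpha>: "\<alpha> \<noteq> 0" using eigenvalue_nonzero[OF _ e] A by (simp add: Gf_def)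
  define D where "D = mat2_mult (1 / \<alpha>, 0, 0, 1 / \<alpha>) A"
  have D: "D \<in> CollGL f"
    unfolding D_def using \<alpha> by (intro CollGL_mult scalar_mem_CollGL Gf_subset_CollGL[OF A]) simp
  have D_pow: "(act D ^^ i) v = sc (1 / \<alpha> ^ i) ((act A ^^ i) v)" for i v
    by (induction i) (simp_all add: D_def act_scalar_mult act_sc mult.commute)
  have C_pow: "C = range (mpow D)"
  proof (intro equalityI subsetI)
    fix B assume B: "B \<in> C"
    then have "B \<in> CollGL f" by (simp add: C_def)
    then obtain k B' where k: "k \<noteq> 0" "B' \<in> Gf f" "B = mat2_mult (k, 0, 0, k) B'"
      by (rule CollGL_decompose)
    obtain i where i: "B' = mpow A i" using gen[OF k(2)] by blast
    have act_B: "act B v = sc k ((act A ^^ i) v)" for v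
      by (simp add: k(3) i act_scalar_mult act_mpow)
    have "sc (k * \<alpha> ^ i) e = sc 1 e"
      using B act_B[of e] funpow_act_eigen[OF e(2)] by (simp add: C_def)
    then have "k * \<alpha> ^ i = 1" using e(1) sc_cancel_right by blast
    then have "k = 1 / \<alpha> ^ i" using \<alpha> by (simp add: field_simps)
    then have "B = mpow D i"
      by (intro mat2_eqI) (simp add: act_B act_mpow D_pow)
    then show "B \<in> range (mpow D)" by blast
  next
    fix B assume "B \<in> range (mpow D)"
    then obtain i where i: "B = mpow D i" by blast
    have "act B e = e"
      using \<alpha> by (simp add: i act_mpow D_pow funpow_act_eigen[OF e(2)])
    then show "B \<in> C" using mpow_mem_CollGL[OF D] by (simp add: C_def i)
  qed
  have "\<exists>c. c \<noteq> 0 \<and> act B e = sc c e" if B: "B \<in> Gf f" for B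
  proof -
    obtain i where "B = mpow A i" using gen[OF B] by blast
    then have "act B e = sc (\<alpha> ^ i) e" by (simp add: act_mpow funpow_act_eigen[OF e(2)])
    then show ?thesis using \<alpha> by (intro exI[of _ "\<alpha> ^ i"]) simp
  qed
  then obtain c where c: "\<And>B. B \<in> Gf f \<Longrightarrow> c B \<noteq> 0" "\<And>B. B \<in> Gf f \<Longrightarrow> act B e = sc (c B) e"
    by metis
  have c_eqI: "c B = k" if "B \<in> Gf f" "act B e = sc k e" for B k
    using c(2)[OF that(1)] that(2) sc_cancel_right[OF e(1)] by simp
  define \<Phi> where "\<Phi> = (\<lambda>B. mat2_mult (1 / c B, 0, 0, 1 / c B) B)"
  have act_\<Phi>: "act (\<Phi> B) v = sc (1 / c B) (act B v)" for B v
    by (simp add: \<Phi>_def act_scalar_mult)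
  have "\<Phi> ` Gf f = C"
  proof (intro equalityI subsetI)
    fix B assume "B \<in> \<Phi> ` Gf f"
    then obtain B' where B': "B' \<in> Gf f" "B = \<Phi> B'" by blast
    have "act B e = e" using c[OF B'(1)] by (simp add: B'(2) act_\<Phi>)
    moreover have "B \<in> CollGL f"
      unfolding B'(2) \<Phi>_def using c(1)[OF B'(1)]
      by (intro CollGL_mult scalar_mem_CollGL Gf_subset_CollGL[OF B'(1)]) simp
    ultimately show "B \<in> C" by (simp add: C_def)
  next
    fix B assume B: "B \<in> C"
    then have "B \<in> CollGL f" by (simp add: C_def)
    then obtain k B' where k: "k \<noteq> 0" "B' \<in> Gf f" "B = mat2_mult (k, 0, 0, k) B'"
      by (rule CollGL_decompose)
    have "sc k (act B' e) = e" using B k(3) by (simp add: C_def act_scalar_mult)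
    then have "act B' e = sc (1 / k) e" using k(1) by (metis sc_simps(3,4) nonzero_eq_divide_eq)
    then have "c B' = 1 / k" using c_eqI k(2) by blast
    then have "\<Phi> B' = B" using k by (simp add: \<Phi>_def)
    then show "B \<in> \<Phi> ` Gf f" using k(2) by blast
  qed
  moreover have "card (Gf f) = (q - 1) * card (\<Phi> ` Gf f)"
  proof (rule card_eq_card_image_mult)
    fix B assume B: "B \<in> Gf f"
    have "{B' \<in> Gf f. \<Phi> B' = \<Phi> B} = (\<lambda>k. mat2_mult (k, 0, 0, k) B) ` (Fq q - {0})"
    proof (intro equalityI subsetI)
      fix B' assume "B' \<in> {B' \<in> Gf f. \<Phi> B' = \<Phi> B}"
      then have B': "B' \<in> Gf f" "\<Phi> B' = \<Phi> B" by auto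
      define k where "k = c B' / c B"
      have k0: "k \<noteq> 0" using c B B' by (simp add: k_def)
      have "act B' v = sc k (act B v)" for v
      proof -
        have "sc (c B') (act (\<Phi> B') v) = sc (c B') (act (\<Phi> B) v)" using B'(2) by simp
        then show ?thesis using c(1)[OF B'(1)] by (simp add: act_\<Phi> k_def)
      qed
      then have eq: "B' = mat2_mult (k, 0, 0, k) B" by (intro mat2_eqI) (simp add: act_scalar_mult)
      then have "k \<in> Fq q" using scalar_mult_mem_Gf_iff[OF B k0] B'(1) by simp
      then show "B' \<in> (\<lambda>k. mat2_mult (k, 0, 0, k) B) ` (Fq q - {0})" using eq k0 by blast
    next
      fix B' assume "B' \<in> (\<lambda>k. mat2_mult (k, 0, 0, k) B) ` (Fq q - {0})"
      then obtain k where k: "k \<in> Fq q" "k \<noteq> 0" "B' = mat2_mult (k, 0, 0, k) B" by blast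
      have B': "B' \<in> Gf f" using scalar_mult_mem_Gf_iff[OF B k(2)] k by simp
      have "act B' e = sc (k * c B) e" using c(2)[OF B] by (simp add: k(3) act_scalar_mult)
      then have "c B' = k * c B" using c_eqI[OF B'] by blast
      then have "act (\<Phi> B') v = act (\<Phi> B) v" for v
        using k(2) by (simp add: act_\<Phi> k(3) act_scalar_mult)
      then have "\<Phi> B' = \<Phi> B" by (rule mat2_eqI)
      then show "B' \<in> {B' \<in> Gf f. \<Phi> B' = \<Phi> B}" using B' by simp
    qed
    moreover have "inj_on (\<lambda>k. mat2_mult (k, 0, 0, k) B) (Fq q - {0})"
    proof (rule inj_onI)
      fix k l assume "mat2_mult (k, 0, 0, k) B = mat2_mult (l, 0, 0, l) B"
      then have "act (mat2_mult (k, 0, 0, k) B) e = act (mat2_mult (l, 0, 0, l) B) e" by simp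
      then have "sc (k * c B) e = sc (l * c B) e" using c(2)[OF B] by (simp add: act_scalar_mult)
      then have "k * c B = l * c B" using e(1) sc_cancel_right by blast
      then show "k = l" using c(1)[OF B] by simp
    qed
    ultimately show "card {B' \<in> Gf f. \<Phi> B' = \<Phi> B} = q - 1"
      using card_Fq_q by (simp add: card_image card_Diff_singleton)
  qed simp
  ultimately have "card (Gf f) = (q - 1) * card C" by simp
  moreover have "D \<in> GL2" using D by (simp add: CollGL_iff)
  ultimately show ?thesis using that C_pow by blast
qed

lemma cyclic_map_group_act:
  fixes D :: "'a mat2"
  assumes "D \<in> GL2" "C = range (mpow D)"
  shows "cyclic_map_group (act ` C) (card C)"
proof -
  have "act ` C = range (\<lambda>k. act D ^^ k)" by (simp add: assms(2) image_image act_mpow)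
  moreover have "card (act ` C) = card C"
    by (rule card_image) (simp add: inj_on_def mat2_eq_iff)
  ultimately show ?thesis
    unfolding cyclic_map_group_def using act_bij[OF assms(1)] by blast
qed

lemma cyclic_stabilizer:
  assumes A: "A \<in> Gf f" and gen: "\<And>B. B \<in> Gf f \<Longrightarrow> \<exists>i. B = mpow A i"
    and order: "mpow A (q ^ t - 1) = mat2_one" and card_G: "card (Gf f) = q ^ t - 1"
    and large: "q - 1 < q ^ t - 1"
  defines "N \<equiv> (q ^ t - 1) div (q - 1)"
  shows "\<exists>G H. cyclic_map_group G N \<and> cyclic_map_group H N \<and> symmetric_affine_homology_groups f G H"
    and "\<not> (\<exists>g ax c. affine_elation f g ax c)"
    and "\<exists>X Y. X \<in> Bf f \<and> Y \<in> Bf f \<and> X \<noteq> Y \<and> X \<in> Dspread \<and> Y \<in> Dspread \<and>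
      (\<forall>g ax c. affine_homology f g ax c \<longrightarrow> c = Inr X \<or> c = Inr Y)"
    and "\<exists>C. mat2_cyclic C \<and> card C = N \<and>
      (\<exists>ax c. \<forall>A\<in>C. A \<noteq> mat2_one \<longrightarrow> affine_homology f (act A) ax c) \<and>
      card (kernel_homologies :: 'a mat2 set) = q ^ n - 1 \<and>
      kernel_homologies \<inter> C = {mat2_one} \<and>
      (\<forall>K\<in>kernel_homologies. \<forall>A\<in>C. mat2_mult K A = mat2_mult A K) \<and>
      CollGL f = {mat2_mult K A | K A. K \<in> kernel_homologies \<and> A \<in> C}"
proof -
  have GL: "A \<in> GL2" using A by (simp add: Gf_def)
  have t: "t > 0" using large by (cases t) auto
  \<comment> \<open>Powers of a scalar matrix are scalar, and \<open>Gf f\<close> contains only q -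
    1 scalars.\<close>
  have nonscalar: "A \<noteq> (k, 0, 0, k)" for k
  proof
    assume Ak: "A = (k, 0, 0, k)"
    have "Gf f \<subseteq> (\<lambda>k. (k, 0, 0, k)) ` (Fq q - {0})"
    proof
      fix B assume B: "B \<in> Gf f"
      then obtain i where i: "B = mpow A i" using gen by blast
      have "B = (k ^ i, 0, 0, k ^ i)"
        unfolding i by (rule mat2_eqI) (simp add: act_mpow act_scalar Ak funpow_act_eigen)
      moreover have "k \<noteq> 0" using GL by (auto simp: Ak GL2_def)
      ultimately show "B \<in> (\<lambda>k. (k, 0, 0, k)) ` (Fq q - {0})"
        using scalar_mem_Gf_iff[of "k ^ i"] B by auto
    qed
    then have "card (Gf f) \<le> q - 1"
      using card_mono[of "(\<lambda>k. (k, 0, 0, k)) ` (Fq q - {0}) :: 'a mat2 set"] card_scalars_Gf by simp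
    then show False using card_G large by simp
  qed
  have qt: "q ^ t > 0" using q3 by simp
  have "act A ^^ q ^ t = act A"
  proof -
    have "mpow A (q ^ t) = mat2_mult A (mpow A (q ^ t - 1))"
      using qt by (metis Suc_pred' mpow_Suc)
    then have "mpow A (q ^ t) = A"
      unfolding order by (simp add: mat2_eq_iff fun_eq_iff act_mult)
    then show ?thesis by (metis act_mpow)
  qed
  moreover obtain e1 \<alpha> where e1: "e1 \<noteq> 0" "act A e1 = sc \<alpha> e1" using Gf_eigenvector[OF A] .
  ultimately obtain e2 \<beta> where e2: "e2 \<notin> span1 e1" "act A e2 = sc \<beta> e2" and ne: "\<alpha> \<noteq> \<beta>"
    using second_eigenvector[OF GL nonscalar _ t] by metis
  have e20: "e2 \<noteq> 0" using e2(1) zero_mem_span1 by metis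
  have e12: "e1 \<notin> span1 e2" using e2(1) e1(1) span1_eqI by (metis self_mem_span1)
  let ?E1 = "span1 e1" and ?E2 = "span1 e2"
  have D: "?E1 \<in> Dspread" "?E2 \<in> Dspread" unfolding Dspread_eq using e1(1) e20 by blast+
  have B1: "?E1 \<in> Bf f"
    using D(1) eigenline_notin_Lf[OF A e1 e2 ne] by (simp add: Bf_eq)
  have B2: "?E2 \<in> Bf f"
    using D(2) eigenline_notin_Lf[OF A e20 e2(2) e12 e1(2) ne[symmetric]] by (simp add: Bf_eq)
  have E12: "?E1 \<noteq> ?E2" using e2(1) by (metis self_mem_span1)
  \<comment> \<open>Every linear collineation is a scalar times a power of \<open>A\<close>, so all
    of them are diagonal in the basis \<open>e1\<close>, \<open>e2\<close>. Those with eigenvalue 1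
    on one basis vector provide the homologies.\<close>
  have diag: "\<exists>a b. a \<noteq> 0 \<and> b \<noteq> 0 \<and> act B e1 = sc a e1 \<and> act B e2 = sc b e2" if B: "B \<in> CollGL f" for B
  proof -
    obtain k B' where k: "k \<noteq> 0" "B' \<in> Gf f" "B = mat2_mult (k, 0, 0, k) B'"
      using B by (rule CollGL_decompose)
    obtain i where i: "B' = mpow A i" using gen[OF k(2)] by blast
    have "act B e1 = sc (k * \<alpha> ^ i) e1" "act B e2 = sc (k * \<beta> ^ i) e2"
      by (simp_all add: k(3) i act_scalar_mult act_mpow funpow_act_eigen e1(2) e2(2))
    moreover have "B \<in> GL2" using B by (simp add: CollGL_iff)
    ultimately show ?thesis using eigenvalue_nonzero e1(1) e20 by blast
  qed
  have act_comb: "act B (sc x e1 + sc y e2) = sc (x * a) e1 + sc (y * b) e2"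
    if "act B e1 = sc a e1" "act B e2 = sc b e2" for B x y a b
    using that by (simp add: act_add act_sc)
  let ?C1 = "{B \<in> CollGL f. act B e1 = e1}" and ?C2 = "{B \<in> CollGL f. act B e2 = e2}"
  have hom1: "affine_homology f (act B) ?E1 (Inr ?E2)" if B: "B \<in> ?C1" "B \<noteq> mat2_one" for B
  proof (rule act_affine_homology)
    show "act B w = w" if "w \<in> ?E1" for w using that B by (auto simp: span1_eq act_sc)
    fix v
    obtain a b where ab: "act B e1 = sc a e1" "act B e2 = sc b e2" using diag B by blast
    then have "a = 1" using B e1(1) sc_cancel_right[OF e1(1), of a 1] by simp
    obtain x y where v: "v = sc x e1 + sc y e2" using combination_exists[OF e1(1) e2(1)] by metis
    have "act B v - v = sc (y * b - y) e2"
      unfolding v act_comb[OF ab] by (simp add: \<open>a = 1\<close> sc_diff_left)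
    then show "act B v - v \<in> ?E2" by simp
  qed (use B B1 B2 E12 in auto)
  have hom2: "affine_homology f (act B) ?E2 (Inr ?E1)" if B: "B \<in> ?C2" "B \<noteq> mat2_one" for B
  proof (rule act_affine_homology)
    show "act B w = w" if "w \<in> ?E2" for w using that B by (auto simp: span1_eq act_sc)
    fix v
    obtain a b where ab: "act B e1 = sc a e1" "act B e2 = sc b e2" using diag B by blast
    then have "b = 1" using B e20 sc_cancel_right[OF e20, of b 1] by simp
    obtain x y where v: "v = sc x e1 + sc y e2" using combination_exists[OF e1(1) e2(1)] by metis
    have "act B v - v = sc (x * a - x) e1"
      unfolding v act_comb[OF ab] by (simp add: \<open>b = 1\<close> sc_diff_left)
    then show "act B v - v \<in> ?E1" by simp
  qed (use B B1 B2 E12 in auto)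
  obtain D1 where D1: "D1 \<in> GL2" "?C1 = range (mpow D1)" "card (Gf f) = (q - 1) * card ?C1"
    by (rule homology_group_cyclic[OF A gen e1])
  obtain D2 where D2: "D2 \<in> GL2" "?C2 = range (mpow D2)" "card (Gf f) = (q - 1) * card ?C2"
    by (rule homology_group_cyclic[OF A gen e20 e2(2)])
  have card_C1: "card ?C1 = N" unfolding N_def card_G[symmetric] D1(3) using q3 by simp
  have card_C2: "card ?C2 = N" unfolding N_def card_G[symmetric] D2(3) using q3 by simp
  have lines: "?E1 \<in> lines f" "?E2 \<in> lines f"
    unfolding lines_def translate_line using B1 B2 S.line_0 by blast+
  have inc: "proj_inc (Inr ?E1) (Some ?E1)" "proj_inc (Inr ?E2) (Some ?E2)"
    using proj_inc_Inr[OF B1 B1, of 0] proj_inc_Inr[OF B2 B2, of 0] by simp_all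
  have cyc1: "cyclic_map_group (act ` ?C1) N"
    using cyclic_map_group_act[OF D1(1,2)] unfolding card_C1 .
  have cyc2: "cyclic_map_group (act ` ?C2) N"
    using cyclic_map_group_act[OF D2(1,2)] unfolding card_C2 .
  have sym: "symmetric_affine_homology_groups f (act ` ?C1) (act ` ?C2)"
    unfolding symmetric_affine_homology_groups_def
  proof (rule exI[of _ ?E1], rule exI[of _ ?E2], intro conjI ballI impI lines)
    fix g assume "g \<in> act ` ?C1" "g \<noteq> id"
    then obtain B where B: "B \<in> ?C1" "g = act B" by blast
    have "B \<noteq> mat2_one" using B \<open>g \<noteq> id\<close> by auto
    then show "\<exists>c. affine_homology f g ?E1 c \<and> proj_inc c (Some ?E2)"
      using hom1 B inc by blast
  next
    fix g assume "g \<in> act ` ?C2" "g \<noteq> id"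
    then obtain B where B: "B \<in> ?C2" "g = act B" by blast
    have "B \<noteq> mat2_one" using B \<open>g \<noteq> id\<close> by auto
    then show "\<exists>c. affine_homology f g ?E2 c \<and> proj_inc c (Some ?E1)"
      using hom2 B inc by blast
  qed
  show "\<exists>G H. cyclic_map_group G N \<and> cyclic_map_group H N \<and> symmetric_affine_homology_groups f G H"
    by (intro exI conjI) (rule cyc1 cyc2 sym)+
  \<comment> \<open>A nonidentity diagonal matrix has an eigenvalue \<open>s\<close> other than 1 on
    \<open>e1\<close> or \<open>e2\<close>. The displacement of that vector e is (s - 1) e, which
    makes \<open>span1 e\<close> the centre; vectors of the axis are fixed, so the axis is a
    different component. This locates all centres and also excludes elations.\<close>
  have central: "\<exists>v w X. w \<noteq> 0 \<and> span1 w \<in> Bf f \<and> X \<in> Bf f \<and> X \<noteq> span1 w \<and> ax = S.line v (span1 w) \<and> c = Inr X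
      \<and> (X = ?E1 \<or> X = ?E2)" if cc: "affine_central f g ax c" for g ax c
  proof -
    obtain v B w X where B: "B \<in> CollGL f" "B \<noteq> mat2_one" and w: "w \<noteq> 0" "act B w = w" "span1 w \<in> Bf f"
      and ax: "ax = S.line v (span1 w)" "c = Inr X" and X: "X \<in> Bf f" "X \<in> Dspread"
      and cen: "\<And>y. act B y - y \<in> X"
      by (rule affine_central_linear[OF cc], rule that)
    obtain x0 where X_eq: "X = span1 x0" using X(2) by (auto simp: Dspread_eq)
    obtain a b where ab: "act B e1 = sc a e1" "act B e2 = sc b e2" using diag[OF B(1)] by blast
    have "a \<noteq> 1 \<or> b \<noteq> 1"
    proof (rule ccontr)
      assume "\<not> ?thesis"
      then have ab1: "a = 1" "b = 1" by auto
      have "act B v = act mat2_one v" for v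
      proof -
        obtain x y where "v = sc x e1 + sc y e2" by (rule combination_exists[OF e1(1) e2(1)])
        then show ?thesis using act_comb[OF ab] ab1 by simp
      qed
      then show False using B(2) mat2_eqI by blast
    qed
    then obtain e s where e: "(e = e1 \<or> e = e2)" "e \<noteq> 0" "act B e = sc s e" "s \<noteq> 1"
      using ab e1(1) e20 by metis
    have "act B e - e = sc (s - 1) e" by (simp add: e(3) sc_diff_left)
    then have "sc (s - 1) e \<in> X" "sc (s - 1) e \<in> span1 e" using cen[of e] by simp_all
    then have XE: "X = span1 e"
      using span1_eqI[of "sc (s - 1) e" x0] span1_eqI[of "sc (s - 1) e" e] e(2,4)
      unfolding X_eq by simp
    have "X \<noteq> span1 w"
    proof
      assume "X = span1 w"
      then have "w \<in> span1 e" using XE by simp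
      then obtain k where k: "w = sc k e" by (auto simp: span1_eq)
      then have "sc (k * s) e = sc k e" using w(2) e(3) by (simp add: act_sc)
      then have "k * s = k" using e(2) sc_cancel_right by blast
      then show False using k w(1) e(4) by simp
    qed
    then show ?thesis using w X ax XE e(1) by blast
  qed
  show "\<not> (\<exists>g ax c. affine_elation f g ax c)"
  proof clarify
    fix g ax c assume el: "affine_elation f g ax c"
    then obtain v w X where "span1 w \<in> Bf f" "X \<in> Bf f" "X \<noteq> span1 w" "ax = S.line v (span1 w)" "c = Inr X"
      using central[of g ax c] unfolding affine_elation_def by blast
    then show False using el proj_inc_Inr by (simp add: affine_elation_def)
  qed
  show "\<exists>X Y. X \<in> Bf f \<and> Y \<in> Bf f \<and> X \<noteq> Y \<and> X \<in> Dspread \<and> Y \<in> Dspread \<and>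
      (\<forall>g ax c. affine_homology f g ax c \<longrightarrow> c = Inr X \<or> c = Inr Y)"
  proof (rule exI[of _ ?E1], rule exI[of _ ?E2], intro conjI allI impI B1 B2 E12 D)
    fix g ax c assume "affine_homology f g ax c"
    then show "c = Inr ?E1 \<or> c = Inr ?E2"
      using central[of g ax c] unfolding affine_homology_def by blast
  qed
  have kerC: "kernel_homologies \<inter> ?C1 = {mat2_one}"
  proof (intro equalityI subsetI)
    fix B assume B: "B \<in> kernel_homologies \<inter> ?C1"
    then obtain k where k: "B = (k, 0, 0, k)" by (auto simp: kernel_homologies_def)
    then have "sc k e1 = sc 1 e1" using B by (simp add: act_scalar)
    then have "k = 1" using e1(1) sc_cancel_right by blast
    then show "B \<in> {mat2_one}" by (simp add: k mat2_one_def)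
  next
    fix B :: "'a mat2" assume "B \<in> {mat2_one}"
    moreover have "mat2_one \<in> (kernel_homologies :: 'a mat2 set)"
      by (auto simp: kernel_homologies_def mat2_one_def)
    ultimately show "B \<in> kernel_homologies \<inter> ?C1" using one_mem_CollGL by simp
  qed
  have comm: "\<forall>K\<in>kernel_homologies. \<forall>A\<in>?C1. mat2_mult K A = mat2_mult A K"
    using scalar_commute by (auto simp: kernel_homologies_def)
  have prod: "CollGL f = {mat2_mult K A | K A. K \<in> kernel_homologies \<and> A \<in> ?C1}"
  proof (intro equalityI subsetI)
    fix B assume B: "B \<in> CollGL f"
    obtain a where a: "a \<noteq> 0" "act B e1 = sc a e1" using diag[OF B] by blast
    define B' where "B' = mat2_mult (1 / a, 0, 0, 1 / a) B"
    have "B' \<in> CollGL f" unfolding B'_def using a by (intro CollGL_mult scalar_mem_CollGL B) simp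
    then have "B' \<in> ?C1" using a by (simp add: B'_def act_scalar_mult)
    moreover have "B = mat2_mult (a, 0, 0, a) B'"
      using a(1) by (intro mat2_eqI) (simp add: B'_def act_scalar_mult)
    moreover have "(a, 0, 0, a) \<in> kernel_homologies" using a(1) by (auto simp: kernel_homologies_def)
    ultimately show "B \<in> {mat2_mult K A | K A. K \<in> kernel_homologies \<and> A \<in> ?C1}" by blast
  next
    fix B assume "B \<in> {mat2_mult K A | K A. K \<in> kernel_homologies \<and> A \<in> ?C1}"
    then obtain K B' where "B = mat2_mult K B'" "K \<in> kernel_homologies" "B' \<in> CollGL f" by blast
    then show "B \<in> CollGL f" using scalar_mem_CollGL
      by (auto simp: kernel_homologies_def intro!: CollGL_mult)
  qed
  have cyc: "mat2_cyclic ?C1"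
    unfolding mat2_cyclic_def D1(2) using D1(1) by (auto simp: mpow_def)
  show "\<exists>C. mat2_cyclic C \<and> card C = N \<and>
      (\<exists>ax c. \<forall>A\<in>C. A \<noteq> mat2_one \<longrightarrow> affine_homology f (act A) ax c) \<and>
      card (kernel_homologies :: 'a mat2 set) = q ^ n - 1 \<and>
      kernel_homologies \<inter> C = {mat2_one} \<and>
      (\<forall>K\<in>kernel_homologies. \<forall>A\<in>C. mat2_mult K A = mat2_mult A K) \<and>
      CollGL f = {mat2_mult K A | K A. K \<in> kernel_homologies \<and> A \<in> C}"
  proof (rule exI[of _ ?C1], intro conjI cyc card_C1 kerC comm prod)
    show "\<exists>ax c. \<forall>A\<in>?C1. A \<noteq> mat2_one \<longrightarrow> affine_homology f (act A) ax c"
      using hom1 by blast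
  qed (simp add: card_kernel_homologies card_K)
qed

end

text \<open>The map x^(q^i) is additive by iterating the Frobenius identity and fixes F_q
  elementwise, so a q-polynomial is F_q-linear.\<close>

lemma qpoly_scattered_map:
  fixes a :: "nat \<Rightarrow> 'a::{field,finite}"
  assumes "prime_power q" "q > 3" "n > 2" "CARD('a) = q ^ n" "scattered q (qpoly q n a)"
  shows "scattered_map q n (qpoly q n a)"
proof
  have add: "(x + y) ^ (q ^ i) = x ^ (q ^ i) + y ^ (q ^ i)" for x y :: 'a and i
    by (induction i) (simp_all add: power_mult mult.commute[of q] add_power_prime_power[OF assms(4,1)])
  show "qpoly q n a (x + y) = qpoly q n a x + qpoly q n a y" for x y
    by (simp add: qpoly_def add distrib_left sum.distrib)
  show "qpoly q n a (c * x) = c * qpoly q n a x" if "c \<in> Fq q" for c x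
  proof -
    have "c ^ (q ^ i) = c" for i
      using that by (induction i) (simp_all add: power_mult Fq_def)
    then show ?thesis by (simp add: qpoly_def power_mult_distrib sum_distrib_left mult.left_commute)
  qed
qed (use assms in auto)

theorem theorem5p4:
  fixes q n t :: nat and a :: "nat \<Rightarrow> 'a::{field,finite}"
  defines "f \<equiv> qpoly q n a"
  assumes q: "prime_power q" and q3: "q > 3" and n2: "n > 2"
    and card: "CARD('a) = q ^ n"
    and scat: "scattered q f"
  shows
    "(card (Gf f) = q - 1 \<longrightarrow>
        \<not> (\<exists>g ax c. affine_central f g ax c) \<and>
        CollGL f = kernel_homologies \<and> card (CollGL f) = q ^ n - 1)
     \<and>
     ((f \<in> S_nq n q \<and> CARD('b::{field,finite}) = q ^ t \<and>
        Gf_group f \<cong> (mult_group_field :: 'b monoid)) \<longrightarrow>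
        (\<exists>G H. cyclic_map_group G ((q ^ t - 1) div (q - 1)) \<and>
               cyclic_map_group H ((q ^ t - 1) div (q - 1)) \<and>
               symmetric_affine_homology_groups f G H) \<and>
        \<not> (\<exists>g ax c. affine_elation f g ax c) \<and>
        (\<exists>X Y. X \<in> Bf f \<and> Y \<in> Bf f \<and> X \<noteq> Y \<and> X \<in> Dspread \<and> Y \<in> Dspread \<and>
           (\<forall>g ax c. affine_homology f g ax c \<longrightarrow> c = Inr X \<or> c = Inr Y)) \<and>
        (\<exists>C. mat2_cyclic C \<and> card C = (q ^ t - 1) div (q - 1) \<and>
           (\<exists>ax c. \<forall>A\<in>C. A \<noteq> mat2_one \<longrightarrow> affine_homology f (act A) ax c) \<and>
           card (kernel_homologies :: 'a mat2 set) = q ^ n - 1 \<and>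
           kernel_homologies \<inter> C = {mat2_one} \<and>
           (\<forall>K\<in>kernel_homologies. \<forall>A\<in>C. mat2_mult K A = mat2_mult A K) \<and>
           CollGL f = {mat2_mult K A | K A. K \<in> kernel_homologies \<and> A \<in> C}))"
proof -
  interpret scattered_map q n f
    unfolding f_def by (rule qpoly_scattered_map) (use q q3 n2 card scat f_def in auto)
  show ?thesis
  proof (rule conjI)
    show "card (Gf f) = q - 1 \<longrightarrow>
        \<not> (\<exists>g ax c. affine_central f g ax c) \<and>
        CollGL f = kernel_homologies \<and> card (CollGL f) = q ^ n - 1"
      using trivial_stabilizer by blast
  next
    show "(f \<in> S_nq n q \<and> CARD('b) = q ^ t \<and> Gf_group f \<cong> (mult_group_field :: 'b monoid)) \<longrightarrow>
        (\<exists>G H. cyclic_map_group G ((q ^ t - 1) div (q - 1)) \<and>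
               cyclic_map_group H ((q ^ t - 1) div (q - 1)) \<and>
               symmetric_affine_homology_groups f G H) \<and>
        \<not> (\<exists>g ax c. affine_elation f g ax c) \<and>
        (\<exists>X Y. X \<in> Bf f \<and> Y \<in> Bf f \<and> X \<noteq> Y \<and> X \<in> Dspread \<and> Y \<in> Dspread \<and>
           (\<forall>g ax c. affine_homology f g ax c \<longrightarrow> c = Inr X \<or> c = Inr Y)) \<and>
        (\<exists>C. mat2_cyclic C \<and> card C = (q ^ t - 1) div (q - 1) \<and>
           (\<exists>ax c. \<forall>A\<in>C. A \<noteq> mat2_one \<longrightarrow> affine_homology f (act A) ax c) \<and>
           card (kernel_homologies :: 'a mat2 set) = q ^ n - 1 \<and>
           kernel_homologies \<inter> C = {mat2_one} \<and>
           (\<forall>K\<in>kernel_homologies. \<forall>A\<in>C. mat2_mult K A = mat2_mult A K) \<and>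
           CollGL f = {mat2_mult K A | K A. K \<in> kernel_homologies \<and> A \<in> C})"
      (is "?H \<longrightarrow> ?C")
    proof
      assume H: ?H
      obtain A where A: "A \<in> Gf f" "\<And>B. B \<in> Gf f \<Longrightarrow> \<exists>i. B = mpow A i"
        "mpow A (q ^ t - 1) = mat2_one" "card (Gf f) = q ^ t - 1"
        using iso_Gf_generator[of f, where 'b='b] H by metis
      \<comment> \<open>Membership in \<open>S_nq\<close> bounds the order of G_f from below, which
        is what makes the generator nonscalar.\<close>
      have "q - 1 < q ^ t - 1" using H A(4) by (simp add: S_nq_def)
      note C = cyclic_stabilizer[OF A this]
      show ?C by (intro conjI C)
    qed
  qed
qed

end
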